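(* There is no function $\mathring\rho(d,\tau)$ with the following property for every $d$ and $\tau$: whenever $G_1,G_2,\ldots$ is an increasing sequence (in number of vertices) of connected $d$-regular graphs such that $\tau(G_i)\to\tau$, then $\rho(G_i)\to\mathring\rho(d,\tau)$.
   Context: For a graph $G$ with $n$ vertices, $\tau(G):=\frac1n\log t(G)$ where $t(G)$ is the number of spanning trees (spanning tree entropy). For $G$ with even degrees, $\operatorname{EO}(G)$ is the number of orientations of the edges such that every vertex has in-degree equal to out-degree, and $\rho(G):=\frac1n\log\operatorname{EO}(G)$. *)

theory Defs
  imports Complex_Main
begin

text \<open>
  The AFP library \<open>Graph_Theory\<close> models undirected graphs as symmetric digraphs and its notion
  of spanning tree only excludes directed cycles, so it is not the notion of a spanning tree of
  an undirected graph. We use vertex sets together with edge sets of two-element sets instead.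
\<close>

record 'a ugraph =
  vertices :: "'a set"
  edges :: "'a set set"

definition simple_graph :: "'a ugraph \<Rightarrow> bool" where
  "simple_graph G \<longleftrightarrow>
     finite (vertices G) \<and> (\<forall>e\<in>edges G. e \<subseteq> vertices G \<and> card e = 2)"

definition adjacent :: "'a ugraph \<Rightarrow> 'a \<Rightarrow> 'a \<Rightarrow> bool" where
  "adjacent G u v \<longleftrightarrow> {u, v} \<in> edges G"

definition degree_of :: "'a ugraph \<Rightarrow> 'a \<Rightarrow> nat" where
  "degree_of G v = card {e \<in> edges G. v \<in> e}"

definition regular_graph :: "nat \<Rightarrow> 'a ugraph \<Rightarrow> bool" where
  "regular_graph d G \<longleftrightarrow> (\<forall>v\<in>vertices G. degree_of G v = d)"

definition connected_graph :: "'a ugraph \<Rightarrow> bool" where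
  "connected_graph G \<longleftrightarrow>
     vertices G \<noteq> {} \<and> (\<forall>u\<in>vertices G. \<forall>v\<in>vertices G. (adjacent G)\<^sup>*\<^sup>* u v)"

definition cycle_in :: "'a ugraph \<Rightarrow> 'a list \<Rightarrow> bool" where
  "cycle_in G p \<longleftrightarrow>
     length p \<ge> 3 \<and> distinct p \<and>
     (\<forall>i<length p. adjacent G (p ! i) (p ! (Suc i mod length p)))"

definition tree_graph :: "'a ugraph \<Rightarrow> bool" where
  "tree_graph G \<longleftrightarrow> connected_graph G \<and> (\<nexists>p. cycle_in G p)"

definition spanning_trees :: "'a ugraph \<Rightarrow> 'a set set set" where
  "spanning_trees G =
     {F. F \<subseteq> edges G \<and> tree_graph \<lparr>vertices = vertices G, edges = F\<rparr>}"

text \<open>An orientation is a set of arcs containing exactly one of \<open>(u, v)\<close>, \<open>(v, u)\<close> for each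
  edge \<open>{u, v}\<close>, and no other arcs.\<close>

definition orientations :: "'a ugraph \<Rightarrow> ('a \<times> 'a) set set" where
  "orientations G =
     {D. (\<forall>(u, v)\<in>D. {u, v} \<in> edges G) \<and>
         (\<forall>u v. {u, v} \<in> edges G \<longrightarrow> ((u, v) \<in> D \<longleftrightarrow> (v, u) \<notin> D))}"

definition Eulerian_orientations :: "'a ugraph \<Rightarrow> ('a \<times> 'a) set set" where
  "Eulerian_orientations G =
     {D \<in> orientations G. \<forall>v\<in>vertices G. card {u. (u, v) \<in> D} = card {w. (v, w) \<in> D}}"

definition spanning_tree_entropy :: "'a ugraph \<Rightarrow> real" where
  "spanning_tree_entropy G =
     ln (real (card (spanning_trees G))) / real (card (vertices G))"

definition residual_entropy :: "'a ugraph \<Rightarrow> real" where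
  "residual_entropy G =
     ln (real (card (Eulerian_orientations G))) / real (card (vertices G))"

end

theory Submission
  imports Defs
begin

text \<open>
  Spanning trees and Eulerian orientations are both multiplicative under gluing two graphs at a
  vertex. Take \<open>d = 4\<close>, start from a leaf block, which is \<open>K\<^sub>5\<close> with a subdivided edge, and
  repeatedly glue on a cycle of length \<open>j + 2\<close> all but two of whose vertices carry leaf blocks.
  If the leaf block has \<open>E\<close> Eulerian orientations and \<open>T\<close> spanning trees, such a step adds
  \<open>6 j + 1\<close> vertices and multiplies the two counts by \<open>2 E\<^sup>j\<close> and \<open>(j + 2) T\<^sup>j\<close>.
  Since \<open>4\<^sup>2 \<noteq> 3 \<cdot> 5\<close> and \<open>E < 2\<^sup>6\<close>, the increments in the number of vertices and the
  two logarithmic counts for \<open>j = 1, 2, 3\<close> are linearly independent, so the proportions of the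
  three kinds of cycles can be varied so as to change \<open>\<rho>\<close> but not \<open>\<tau>\<close>.
\<close>

section \<open>Spanning trees as minimal connected edge sets\<close>

text \<open>Why the two inequalities decide independence: as functions of \<open>j\<close>, the
  vertex increment \<open>6 j + 1\<close> and the orientation increment \<open>ln 2 + j ln E\<close>
  lie in the plane spanned by 1 and \<open>j\<close>, and they are proportional exactly when
  \<open>ln E = 6 ln 2\<close>. The tree increment \<open>ln (j + 2) + j ln T\<close> leaves that
  plane exactly when the second difference of \<open>ln (j + 2)\<close> over
  \<open>j = 1, 2, 3\<close> is nonzero. So no exact count for the leaf is computed:
  \<open>0 < E < 64\<close> and \<open>0 < T\<close> are all that enters. Three kinds of cycles are
  used because two quantities, size and number of trees, are held fixed. The exponent 6 is also the
  number of leaf edges outside a spanning tree, \<open>11 - 5\<close>, so \<open>E \<le> 2^6\<close>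
  is automatic and the work lies in making it strict. Spanning trees are defined by the absence of
  cycles given as vertex lists, which is awkward across a cut vertex; minimal connected edge sets
  split cleanly there. Vertices of degree 2 are the open places of an unfinished graph: identifying
  two of them produces a vertex of degree 4, and a final leaf closes the last one.\<close>

abbreviation joined :: "'a set set \<Rightarrow> 'a \<Rightarrow> 'a \<Rightarrow> bool" where
  "joined F \<equiv> (\<lambda>x y. {x, y} \<in> F)\<^sup>*\<^sup>*"

abbreviation spans :: "'a set \<Rightarrow> 'a set set \<Rightarrow> bool" where
  "spans V F \<equiv> connected_graph \<lparr>vertices = V, edges = F\<rparr>"

lemma spans_iff: "spans V F \<longleftrightarrow> V \<noteq> {} \<and> (\<forall>u\<in>V. \<forall>v\<in>V. joined F u v)"
proof -
  have "adjacent \<lparr>vertices = V, edges = F\<rparr> = (\<lambda>x y. {x, y} \<in> F)"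
    by (intro ext) (simp add: adjacent_def)
  then show ?thesis
    by (simp add: connected_graph_def)
qed

lemma spans_graph: "spans (vertices G) (edges G) \<longleftrightarrow> connected_graph G"
  by (cases G) simp

lemma joined_sym: "joined F u v \<Longrightarrow> joined F v u"
proof (induction rule: rtranclp_induct)
  case (step y z)
  then show ?case
    by (metis (mono_tags, lifting) converse_rtranclp_into_rtranclp insert_commute)
qed simp

lemma joined_mono:
  assumes "joined F u v" "F \<subseteq> F'"
  shows "joined F' u v"
  using assms(1)
  by (induction rule: rtranclp_induct) (use assms(2) in \<open>auto intro: rtranclp.rtrancl_into_rtrancl\<close>)

lemma spans_mono: "F \<subseteq> F' \<Longrightarrow> spans V F \<Longrightarrow> spans V F'"
  using joined_mono[of F _ _ F'] by (simp add: spans_iff)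

lemma spans_if_joined_root:
  assumes "r \<in> V" "\<And>v. v \<in> V \<Longrightarrow> joined F r v"
  shows "spans V F"
  unfolding spans_iff
proof (intro conjI ballI)
  fix u v assume "u \<in> V" "v \<in> V"
  then show "joined F u v"
    using rtranclp_trans[OF joined_sym[OF assms(2)[of u]] assms(2)[of v]] by blast
qed (use assms(1) in auto)

section \<open>Cycles versus redundant edges\<close>

lemma rtranclp_distinct_path:
  assumes "r\<^sup>*\<^sup>* u v"
  obtains p where "p \<noteq> []" "hd p = u" "last p = v" "distinct p" "successively r p"
proof -
  from assms have "\<exists>p. p \<noteq> [] \<and> hd p = u \<and> last p = v \<and> distinct p \<and> successively r p"
  proof (induction rule: rtranclp_induct)
    case base
    show ?case by (rule exI[of _ "[u]"]) simp
  next
    case (step y z)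
    then obtain p where p: "p \<noteq> []" "hd p = u" "last p = y" "distinct p" "successively r p"
      by blast
    show ?case
    proof (cases "z \<in> set p")
      case True
      \<comment> \<open>The new vertex already lies on the path: the loop is cut off by truncating
        the path there.\<close>
      then obtain xs ys where "p = xs @ z # ys" by (meson split_list)
      then show ?thesis
        using p by (intro exI[of _ "xs @ [z]"]) (auto simp: successively_append_iff hd_append)
    next
      case False
      then show ?thesis
        using p step(2) by (intro exI[of _ "p @ [z]"]) (auto simp: successively_append_iff)
    qed
  qed
  then show ?thesis using that by blast
qed

text \<open>The edge closing the list \<open>p\<close> can be deleted, because the rest of the cycle
  still joins its two ends and replaces it in every walk.\<close>

lemma cycle_edge_redundant:
  assumes "cycle_in \<lparr>vertices = V, edges = F\<rparr> p" and "spans V F"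
  obtains e where "e \<in> F" "spans V (F - {e})"
proof
  define n where "n = length p"
  have n: "n \<ge> 3" and dist: "distinct p"
    and adj: "\<And>i. i < n \<Longrightarrow> {p ! i, p ! (Suc i mod n)} \<in> F"
    using assms(1) by (auto simp: cycle_in_def adjacent_def n_def)
  let ?e = "{p ! 0, p ! (n - 1)}"
  show "?e \<in> F"
    using adj[of "n - 1"] n by (simp add: insert_commute)
  \<comment> \<open>The steps along the list avoid the closing edge. This uses
    \<open>n \<ge> 3\<close>; with two vertices the only step would be the closing edge
    itself.\<close>
  have ne: "{p ! i, p ! Suc i} \<noteq> ?e" if "Suc i < n" for i
  proof -
    have len: "0 < length p" "n - 1 < length p" "i < length p" "Suc i < length p"
      using that n by (auto simp: n_def)
    have "p ! Suc i \<noteq> p ! 0"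
      using dist len by (simp add: nth_eq_iff_index_eq)
    moreover have "\<not> (p ! i = p ! 0 \<and> p ! Suc i = p ! (n - 1))"
    proof
      assume "p ! i = p ! 0 \<and> p ! Suc i = p ! (n - 1)"
      then have "i = 0" "Suc i = n - 1"
        using dist len nth_eq_iff_index_eq by blast+
      then show False using n by linarith
    qed
    ultimately show ?thesis
      unfolding doubleton_eq_iff by blast
  qed
  have "joined (F - {?e}) (p ! 0) (p ! i)" if "i < n" for i
    using that
  proof (induction i)
    case (Suc i)
    then have "joined (F - {?e}) (p ! 0) (p ! i)" by simp
    moreover have "{p ! i, p ! Suc i} \<in> F - {?e}"
      using adj[of i] ne[of i] Suc by simp
    ultimately show ?case by (rule rtranclp.rtrancl_into_rtrancl)
  qed simp
  then have around: "joined (F - {?e}) (p ! 0) (p ! (n - 1))"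
    using n by simp
  have "joined (F - {?e}) u v" if "joined F u v" for u v
    using that
  proof (induction rule: rtranclp_induct)
    case (step y z)
    have "joined (F - {?e}) y z"
    proof (cases "{y, z} = ?e")
      case True
      then show ?thesis
        using around joined_sym[OF around] by (auto simp: doubleton_eq_iff)
    next
      case False
      then show ?thesis using step(2) by blast
    qed
    then show ?case using step(3) by simp
  qed simp
  then show "spans V (F - {?e})"
    using assms(2) by (simp add: spans_iff)
qed

text \<open>A repetition-free path between the ends of \<open>e\<close> that avoids \<open>e\<close>
  is closed to a cycle by \<open>e\<close>.\<close>

lemma redundant_edge_cycle:
  assumes "e \<in> F" "e \<subseteq> V" "card e = 2" "spans V (F - {e})"
  shows "\<exists>p. cycle_in \<lparr>vertices = V, edges = F\<rparr> p"
proof -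
  obtain u v where e: "e = {u, v}" "u \<noteq> v"
    using assms(3) by (meson card_2_iff)
  then have "joined (F - {e}) u v"
    using assms by (auto simp: spans_iff)
  then obtain p where p: "p \<noteq> []" "hd p = u" "last p = v" "distinct p"
    and succ: "successively (\<lambda>x y. {x, y} \<in> F - {e}) p"
    by (rule rtranclp_distinct_path)
  define n where "n = length p"
  have ends: "p ! 0 = u" "p ! (n - 1) = v"
    using p by (simp_all add: hd_conv_nth last_conv_nth n_def)
  have step: "{p ! i, p ! Suc i} \<in> F - {e}" if "Suc i < n" for i
    using succ that by (auto simp: successively_conv_nth n_def)
  \<comment> \<open>Length 1 would identify the two ends of \<open>e\<close>, and length 2 would
    make the single step equal to \<open>e\<close>.\<close>
  have "n \<noteq> 0" "n \<noteq> 1" "n \<noteq> 2"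
    using p ends e step[of 0] by (auto simp: n_def)
  then have "n \<ge> 3" by linarith
  moreover have "{p ! i, p ! (Suc i mod n)} \<in> F" if "i < n" for i
  proof (cases "Suc i = n")
    case True
    then have "i = n - 1" by simp
    then show ?thesis using ends e(1) assms(1) True by (simp add: insert_commute)
  next
    case False
    then show ?thesis using step[of i] that by simp
  qed
  ultimately show ?thesis
    using p(4) by (intro exI[of _ p]) (simp add: cycle_in_def adjacent_def n_def)
qed

text \<open>Acyclicity of a connected edge set means that no edge is redundant. All later work on
  spanning trees of unions, copies and cycles uses this form, which mentions connectivity
  only.\<close>

lemma spanning_trees_eq_minimal:
  assumes "simple_graph G"
  shows "spanning_trees G =
    {F. F \<subseteq> edges G \<and> spans (vertices G) F \<and> (\<forall>e\<in>F. \<not> spans (vertices G) (F - {e}))}"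
proof -
  have "(\<nexists>p. cycle_in \<lparr>vertices = vertices G, edges = F\<rparr> p)
      \<longleftrightarrow> (\<forall>e\<in>F. \<not> spans (vertices G) (F - {e}))"
    if "F \<subseteq> edges G" "spans (vertices G) F" for F
  proof
    assume acyclic: "\<nexists>p. cycle_in \<lparr>vertices = vertices G, edges = F\<rparr> p"
    show "\<forall>e\<in>F. \<not> spans (vertices G) (F - {e})"
    proof (intro ballI notI)
      fix e assume "e \<in> F" "spans (vertices G) (F - {e})"
      moreover from \<open>e \<in> F\<close> have "e \<subseteq> vertices G" "card e = 2"
        using that assms by (auto simp: simple_graph_def)
      ultimately show False
        using redundant_edge_cycle acyclic by blast
    qed
  next
    assume "\<forall>e\<in>F. \<not> spans (vertices G) (F - {e})"
    then show "\<nexists>p. cycle_in \<lparr>vertices = vertices G, edges = F\<rparr> p"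
      using cycle_edge_redundant that(2) by blast
  qed
  then show ?thesis
    unfolding spanning_trees_def tree_graph_def by blast
qed

lemma finite_edges: "simple_graph G \<Longrightarrow> finite (edges G)"
  by (rule finite_subset[of _ "Pow (vertices G)"]) (auto simp: simple_graph_def)

lemma finite_spanning_trees: "simple_graph G \<Longrightarrow> finite (spanning_trees G)"
  by (rule finite_subset[of _ "Pow (edges G)"]) (auto simp: spanning_trees_def finite_edges)

lemma spanning_trees_nonempty:
  assumes "simple_graph G" "connected_graph G"
  shows "spanning_trees G \<noteq> {}"
proof -
  define A where "A = {F. F \<subseteq> edges G \<and> spans (vertices G) F}"
  have "edges G \<in> A"
    using assms(2) by (simp add: A_def spans_graph)
  moreover have "finite A"
    unfolding A_def using finite_edges[OF assms(1)] by simp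
  ultimately obtain F where F: "F \<in> A" "\<forall>F'\<in>A. F' \<subseteq> F \<longrightarrow> F = F'"
    using finite_has_minimal2[of A "edges G"] by metis
  have "\<not> spans (vertices G) (F - {e})" if "e \<in> F" for e
  proof
    assume "spans (vertices G) (F - {e})"
    then have "F - {e} \<in> A"
      using F(1) by (auto simp: A_def)
    then show False
      using F(2) that by blast
  qed
  then have "F \<in> spanning_trees G"
    using F(1) unfolding spanning_trees_eq_minimal[OF assms(1)] A_def by simp
  then show ?thesis by blast
qed

section \<open>Gluing two graphs at a vertex\<close>

definition union_graph :: "'a ugraph \<Rightarrow> 'a ugraph \<Rightarrow> 'a ugraph" where
  "union_graph G H = \<lparr>vertices = vertices G \<union> vertices H, edges = edges G \<union> edges H\<rparr>"

section \<open>Degree sums of orientations\<close>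

abbreviation indegree :: "('a \<times> 'a) set \<Rightarrow> 'a \<Rightarrow> nat" where
  "indegree D v \<equiv> card {u. (u, v) \<in> D}"

abbreviation outdegree :: "('a \<times> 'a) set \<Rightarrow> 'a \<Rightarrow> nat" where
  "outdegree D v \<equiv> card {w. (v, w) \<in> D}"

lemma orientation_subset:
  assumes "simple_graph G" "D \<in> orientations G"
  shows "D \<subseteq> vertices G \<times> vertices G"
proof (rule subrelI)
  fix x y assume "(x, y) \<in> D"
  then have "{x, y} \<in> edges G"
    using assms(2) by (auto simp: orientations_def)
  then have "{x, y} \<subseteq> vertices G"
    using assms(1) unfolding simple_graph_def by blast
  then show "(x, y) \<in> vertices G \<times> vertices G" by simp
qed

lemma finite_orientation:
  assumes "simple_graph G" "D \<in> orientations G"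
  shows "finite D"
  using finite_subset[OF orientation_subset[OF assms]] assms(1)
  by (simp add: simple_graph_def)

lemma finite_Eulerian_orientations:
  assumes "simple_graph G"
  shows "finite (Eulerian_orientations G)"
proof (rule finite_subset)
  show "Eulerian_orientations G \<subseteq> Pow (vertices G \<times> vertices G)"
    using orientation_subset[OF assms] by (auto simp: Eulerian_orientations_def)
  show "finite (Pow (vertices G \<times> vertices G))"
    using assms by (simp add: simple_graph_def)
qed

lemma sum_indegree:
  assumes "finite V" "D \<subseteq> V \<times> V"
  shows "(\<Sum>v\<in>V. indegree D v) = card D"
proof -
  have "finite {u. (u, v) \<in> D}" for v
    using assms by (intro finite_subset[of "{u. (u, v) \<in> D}" V]) auto
  then have "(\<Sum>v\<in>V. indegree D v) = card (SIGMA v:V. {u. (u, v) \<in> D})"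
    using assms(1) by simp
  \<comment> \<open>The sum type lists pairs as (head, tail), hence the converse.\<close>
  also have "(SIGMA v:V. {u. (u, v) \<in> D}) = D\<inverse>"
    using assms(2) by auto
  finally show ?thesis by simp
qed

lemma sum_outdegree:
  assumes "finite V" "D \<subseteq> V \<times> V"
  shows "(\<Sum>v\<in>V. outdegree D v) = card D"
  using sum_indegree[of V "D\<inverse>"] assms by auto

text \<open>In-degrees and out-degrees both sum to the number of arcs, so the imbalances sum to zero
  and a single one cannot survive. At a cut vertex this makes each side balanced on its own, which
  is why Eulerian orientations multiply.\<close>

lemma balanced_at_last_vertex:
  assumes "finite V" "D \<subseteq> V \<times> V" "u \<in> V"
    and "\<And>v. v \<in> V - {u} \<Longrightarrow> indegree D v = outdegree D v"
  shows "indegree D u = outdegree D u"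
proof -
  have "(\<Sum>v\<in>V. indegree D v) = (\<Sum>v\<in>V. outdegree D v)"
    using assms(1,2) by (simp add: sum_indegree sum_outdegree)
  moreover have "(\<Sum>v\<in>V - {u}. indegree D v) = (\<Sum>v\<in>V - {u}. outdegree D v)"
    using assms(4) by (rule sum.cong[OF refl])
  ultimately show ?thesis
    using assms(1,3) by (simp add: sum.remove)
qed

locale one_point_union =
  fixes G1 G2 :: "'a ugraph" and u :: 'a
  assumes simple1: "simple_graph G1" and simple2: "simple_graph G2"
    and meet: "vertices G1 \<inter> vertices G2 = {u}"
begin

lemma root_in: "u \<in> vertices G1" "u \<in> vertices G2"
  using meet by auto

lemma edge_subset:
  "e \<in> edges G1 \<Longrightarrow> e \<subseteq> vertices G1" "e \<in> edges G2 \<Longrightarrow> e \<subseteq> vertices G2"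
  using simple1 simple2 by (simp_all add: simple_graph_def)

lemma edges_disjoint: "edges G1 \<inter> edges G2 = {}"
proof (rule ccontr)
  assume "edges G1 \<inter> edges G2 \<noteq> {}"
  then obtain e where e: "e \<in> edges G1" "e \<in> edges G2" by auto
  then have "e \<subseteq> {u}"
    using edge_subset meet by blast
  then have "card e \<le> card {u}"
    by (rule card_mono[rotated]) simp
  moreover have "card e = 2"
    using e(1) simple1 by (simp add: simple_graph_def)
  ultimately show False by simp
qed

lemma simple_union: "simple_graph (union_graph G1 G2)"
  using simple1 simple2 by (auto simp: simple_graph_def union_graph_def)

text \<open>Collapsing the second graph to the common vertex maps walks of the union to walks of the
  first graph.\<close>

lemma joined_collapse:
  assumes "joined (F1 \<union> F2) x y" "F1 \<subseteq> edges G1" "F2 \<subseteq> edges G2"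
  shows "joined F1 (if x \<in> vertices G1 then x else u) (if y \<in> vertices G1 then y else u)"
  using assms(1)
proof (induction rule: rtranclp_induct)
  case (step y z)
  show ?case
  proof (cases "{y, z} \<in> F1")
    case True
    then have "y \<in> vertices G1" "z \<in> vertices G1"
      using assms(2) edge_subset(1) by blast+
    then show ?thesis
      using step.IH True by (simp add: rtranclp.rtrancl_into_rtrancl)
  next
    case False
    then have "{y, z} \<subseteq> vertices G2"
      using step.hyps(2) assms(3) edge_subset(2) by blast
    then have "y \<in> vertices G1 \<Longrightarrow> y = u" "z \<in> vertices G1 \<Longrightarrow> z = u"
      using meet by blast+
    then show ?thesis
      using step.IH by (auto split: if_splits)
  qed
qed simp

text \<open>The collapse fixes \<open>u\<close> and all vertices of \<open>G1\<close>, so a walk of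
  the union between such vertices becomes a walk in \<open>F1\<close>.\<close>

lemma spans_part1:
  assumes "spans (vertices G1 \<union> vertices G2) (F1 \<union> F2)" "F1 \<subseteq> edges G1" "F2 \<subseteq> edges G2"
  shows "spans (vertices G1) F1"
proof -
  have "joined F1 u v" if "v \<in> vertices G1" for v
  proof -
    have "joined (F1 \<union> F2) u v"
      using assms(1) that root_in by (simp add: spans_iff)
    from joined_collapse[OF this assms(2,3)] show ?thesis
      using that root_in by simp
  qed
  with root_in(1) show ?thesis
    by (rule spans_if_joined_root)
qed

end

lemma one_point_union_commute: "one_point_union G1 G2 u \<Longrightarrow> one_point_union G2 G1 u"
  unfolding one_point_union_def by (simp add: Int_commute)

context one_point_union
begin

lemma spans_union_iff:
  assumes "F1 \<subseteq> edges G1" "F2 \<subseteq> edges G2"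
  shows "spans (vertices G1 \<union> vertices G2) (F1 \<union> F2)
    \<longleftrightarrow> spans (vertices G1) F1 \<and> spans (vertices G2) F2"
proof
  assume *: "spans (vertices G1 \<union> vertices G2) (F1 \<union> F2)"
  interpret swap: one_point_union G2 G1 u
    by (rule one_point_union_commute) unfold_locales
  show "spans (vertices G1) F1 \<and> spans (vertices G2) F2"
    using spans_part1[of F1 F2] swap.spans_part1[of F2 F1] * assms by (simp add: Un_commute)
next
  assume *: "spans (vertices G1) F1 \<and> spans (vertices G2) F2"
  show "spans (vertices G1 \<union> vertices G2) (F1 \<union> F2)"
  proof (rule spans_if_joined_root)
    show "u \<in> vertices G1 \<union> vertices G2"
      using root_in by simp
    fix v assume "v \<in> vertices G1 \<union> vertices G2"
    then have "joined F1 u v \<or> joined F2 u v"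
      using * root_in by (auto simp: spans_iff)
    then show "joined (F1 \<union> F2) u v"
      using joined_mono[of F1 u v "F1 \<union> F2"] joined_mono[of F2 u v "F1 \<union> F2"] by auto
  qed
qed

lemma connected_union:
  assumes "connected_graph G1" "connected_graph G2"
  shows "connected_graph (union_graph G1 G2)"
  using assms spans_union_iff[of "edges G1" "edges G2"]
  by (simp add: union_graph_def spans_graph)

lemma union_inject:
  assumes "F1 \<subseteq> edges G1" "F2 \<subseteq> edges G2" "F1' \<subseteq> edges G1" "F2' \<subseteq> edges G2"
    "F1 \<union> F2 = F1' \<union> F2'"
  shows "F1 = F1' \<and> F2 = F2'"
proof -
  have "F1 = (F1 \<union> F2) \<inter> edges G1" "F2 = (F1 \<union> F2) \<inter> edges G2"
    "F1' = (F1' \<union> F2') \<inter> edges G1" "F2' = (F1' \<union> F2') \<inter> edges G2"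
    using assms(1-4) edges_disjoint by auto
  then show ?thesis using assms(5) by metis
qed

text \<open>Removing an edge affects one side only, so by \<open>spans_union_iff\<close>
  connectivity and minimality of the union split into the same properties of the two parts.\<close>

lemma union_in_spanning_trees_iff:
  assumes "F1 \<subseteq> edges G1" "F2 \<subseteq> edges G2"
  shows "F1 \<union> F2 \<in> spanning_trees (union_graph G1 G2)
    \<longleftrightarrow> F1 \<in> spanning_trees G1 \<and> F2 \<in> spanning_trees G2"
proof -
  let ?V = "vertices G1 \<union> vertices G2"
  have "spans ?V ((F1 \<union> F2) - {e}) \<longleftrightarrow> spans (vertices G1) (F1 - {e}) \<and> spans (vertices G2) F2"
    if "e \<in> F1" for e
  proof -
    have "(F1 \<union> F2) - {e} = (F1 - {e}) \<union> F2"
      using that assms edges_disjoint by auto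
    then show ?thesis
      using spans_union_iff[of "F1 - {e}" F2] assms by (simp add: subset_iff)
  qed
  moreover have "spans ?V ((F1 \<union> F2) - {e})
      \<longleftrightarrow> spans (vertices G1) F1 \<and> spans (vertices G2) (F2 - {e})"
    if "e \<in> F2" for e
  proof -
    have "(F1 \<union> F2) - {e} = F1 \<union> (F2 - {e})"
      using that assms edges_disjoint by auto
    then show ?thesis
      using spans_union_iff[of F1 "F2 - {e}"] assms by (simp add: subset_iff)
  qed
  moreover have "F1 \<union> F2 \<subseteq> edges G1 \<union> edges G2"
    using assms by (rule Un_mono)
  moreover have "F1 \<union> F2 \<in> spanning_trees (union_graph G1 G2) \<longleftrightarrow>
      F1 \<union> F2 \<subseteq> edges G1 \<union> edges G2 \<and> spans ?V (F1 \<union> F2)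
      \<and> (\<forall>e\<in>F1. \<not> spans ?V (F1 \<union> F2 - {e})) \<and> (\<forall>e\<in>F2. \<not> spans ?V (F1 \<union> F2 - {e}))"
    unfolding spanning_trees_eq_minimal[OF simple_union] mem_Collect_eq ball_Un
    by (simp only: union_graph_def ugraph.simps)
  ultimately show ?thesis
    unfolding spanning_trees_eq_minimal[OF simple1] spanning_trees_eq_minimal[OF simple2]
    using spans_union_iff[OF assms] assms by (simp cong: ball_cong) blast
qed

text \<open>Taking unions is a bijection from pairs of trees; the two parts are recovered by
  intersecting with the disjoint edge sets.\<close>

lemma card_spanning_trees_union:
  "card (spanning_trees (union_graph G1 G2)) = card (spanning_trees G1) * card (spanning_trees G2)"
proof -
  let ?S = "spanning_trees G1 \<times> spanning_trees G2"
  have sub: "F \<subseteq> edges G" if "F \<in> spanning_trees G" for F and G :: "'a ugraph"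
    using that by (simp add: spanning_trees_def)
  have "spanning_trees (union_graph G1 G2) = (\<lambda>(F1, F2). F1 \<union> F2) ` ?S"
  proof (intro equalityI subsetI)
    fix F assume F: "F \<in> spanning_trees (union_graph G1 G2)"
    define F1 F2 where "F1 = F \<inter> edges G1" and "F2 = F \<inter> edges G2"
    have "F = F1 \<union> F2"
      using sub[OF F] by (auto simp: F1_def F2_def union_graph_def)
    moreover have "F1 \<subseteq> edges G1" "F2 \<subseteq> edges G2"
      by (simp_all add: F1_def F2_def)
    ultimately have "F1 \<in> spanning_trees G1" "F2 \<in> spanning_trees G2"
      using F union_in_spanning_trees_iff[of F1 F2] by simp_all
    then show "F \<in> (\<lambda>(F1, F2). F1 \<union> F2) ` ?S"
      using \<open>F = F1 \<union> F2\<close> by force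
  next
    fix F assume "F \<in> (\<lambda>(F1, F2). F1 \<union> F2) ` ?S"
    then obtain F1 F2 where "F = F1 \<union> F2" "F1 \<in> spanning_trees G1" "F2 \<in> spanning_trees G2"
      by auto
    then show "F \<in> spanning_trees (union_graph G1 G2)"
      using union_in_spanning_trees_iff[of F1 F2] sub by simp
  qed
  moreover have "inj_on (\<lambda>(F1, F2). F1 \<union> F2) ?S"
  proof (rule inj_onI, clarify)
    fix F1 F2 F1' F2'
    assume "F1 \<in> spanning_trees G1" "F2 \<in> spanning_trees G2"
      "F1' \<in> spanning_trees G1" "F2' \<in> spanning_trees G2" "F1 \<union> F2 = F1' \<union> F2'"
    then show "F1 = F1' \<and> F2 = F2'"
      by (intro union_inject sub)
  qed
  ultimately show ?thesis
    by (simp add: card_image card_cartesian_product)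
qed

section \<open>Degrees and orientations of a one-point union\<close>

lemma degree_union:
  "degree_of (union_graph G1 G2) v = degree_of G1 v + degree_of G2 v"
proof -
  have "{e \<in> edges (union_graph G1 G2). v \<in> e} = {e \<in> edges G1. v \<in> e} \<union> {e \<in> edges G2. v \<in> e}"
    by (auto simp: union_graph_def)
  moreover have "{e \<in> edges G1. v \<in> e} \<inter> {e \<in> edges G2. v \<in> e} = {}"
    using edges_disjoint by auto
  ultimately show ?thesis
    using finite_edges[OF simple1] finite_edges[OF simple2]
    by (simp add: degree_of_def card_Un_disjoint)
qed

lemma degree_outside:
  "v \<notin> vertices G1 \<Longrightarrow> degree_of G1 v = 0" "v \<notin> vertices G2 \<Longrightarrow> degree_of G2 v = 0"
proof -
  assume "v \<notin> vertices G1"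
  then have "{e \<in> edges G1. v \<in> e} = {}"
    using edge_subset(1) by blast
  then show "degree_of G1 v = 0"
    unfolding degree_of_def by (simp only: card.empty)
next
  assume "v \<notin> vertices G2"
  then have "{e \<in> edges G2. v \<in> e} = {}"
    using edge_subset(2) by blast
  then show "degree_of G2 v = 0"
    unfolding degree_of_def by (simp only: card.empty)
qed

text \<open>The hypotheses say only that arcs lie over edges, since this is what is known of the two
  restrictions of an orientation of the union before they are shown to be orientations.\<close>

lemma union_in_orientations_iff:
  assumes "\<And>x y. (x, y) \<in> D1 \<Longrightarrow> {x, y} \<in> edges G1" "\<And>x y. (x, y) \<in> D2 \<Longrightarrow> {x, y} \<in> edges G2"
  shows "D1 \<union> D2 \<in> orientations (union_graph G1 G2)
    \<longleftrightarrow> D1 \<in> orientations G1 \<and> D2 \<in> orientations G2"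
proof -
  have 1: "(x, y) \<in> D1 \<union> D2 \<longleftrightarrow> (x, y) \<in> D1" "(y, x) \<in> D1 \<union> D2 \<longleftrightarrow> (y, x) \<in> D1"
    if "{x, y} \<in> edges G1" for x y
    using that assms(2)[of x y] assms(2)[of y x] edges_disjoint by (auto simp: insert_commute)
  have 2: "(x, y) \<in> D1 \<union> D2 \<longleftrightarrow> (x, y) \<in> D2" "(y, x) \<in> D1 \<union> D2 \<longleftrightarrow> (y, x) \<in> D2"
    if "{x, y} \<in> edges G2" for x y
    using that assms(1)[of x y] assms(1)[of y x] edges_disjoint by (auto simp: insert_commute)
  have "D1 \<in> orientations G1
      \<longleftrightarrow> (\<forall>x y. {x, y} \<in> edges G1 \<longrightarrow> ((x, y) \<in> D1 \<union> D2 \<longleftrightarrow> (y, x) \<notin> D1 \<union> D2))"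
    using assms(1) 1 by (auto simp: orientations_def)
  moreover have "D2 \<in> orientations G2
      \<longleftrightarrow> (\<forall>x y. {x, y} \<in> edges G2 \<longrightarrow> ((x, y) \<in> D1 \<union> D2 \<longleftrightarrow> (y, x) \<notin> D1 \<union> D2))"
    using assms(2) 2 by (auto simp: orientations_def)
  moreover have "D1 \<union> D2 \<in> orientations (union_graph G1 G2)
      \<longleftrightarrow> (\<forall>x y. {x, y} \<in> edges G1 \<union> edges G2 \<longrightarrow> ((x, y) \<in> D1 \<union> D2 \<longleftrightarrow> (y, x) \<notin> D1 \<union> D2))"
    using assms by (fastforce simp: orientations_def union_graph_def)
  ultimately show ?thesis
    by blast
qed

lemma degrees_of_union:
  assumes D1: "D1 \<in> orientations G1" and D2: "D2 \<in> orientations G2"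
  shows "indegree (D1 \<union> D2) v = indegree D1 v + indegree D2 v"
    and "outdegree (D1 \<union> D2) v = outdegree D1 v + outdegree D2 v"
proof -
  have fin: "finite {w. (v, w) \<in> D}" "finite {w. (w, v) \<in> D}" if "finite D"
    for D :: "('a \<times> 'a) set"
    using finite_subset[of "{w. (v, w) \<in> D}" "snd ` D"]
      finite_subset[of "{w. (w, v) \<in> D}" "fst ` D"] that by force+
  have "D1 \<inter> D2 = {}"
    using D1 D2 edges_disjoint by (fastforce simp: orientations_def)
  then have disj: "{w. (w, v) \<in> D1} \<inter> {w. (w, v) \<in> D2} = {}"
    "{w. (v, w) \<in> D1} \<inter> {w. (v, w) \<in> D2} = {}"
    by auto
  note fin = fin[OF finite_orientation[OF simple1 D1]] fin[OF finite_orientation[OF simple2 D2]]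
  show "indegree (D1 \<union> D2) v = indegree D1 v + indegree D2 v"
    using card_Un_disjoint[OF fin(2) fin(4) disj(1)] by (simp add: Collect_disj_eq)
  show "outdegree (D1 \<union> D2) v = outdegree D1 v + outdegree D2 v"
    using card_Un_disjoint[OF fin(1) fin(3) disj(2)] by (simp add: Collect_disj_eq)
qed

text \<open>Away from \<open>u\<close> the arcs of \<open>D2\<close> contribute nothing, and at
  \<open>u\<close> the balance follows from \<open>balanced_at_last_vertex\<close>. The hypothesis
  is symmetric in the two sides, so the swapped interpretation yields the other half.\<close>

lemma balanced_part1:
  assumes D1: "D1 \<in> orientations G1" and D2: "D2 \<in> orientations G2"
    and bal: "\<And>v. v \<in> vertices G1 \<union> vertices G2 \<Longrightarrow> indegree (D1 \<union> D2) v = outdegree (D1 \<union> D2) v"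
  shows "D1 \<in> Eulerian_orientations G1"
proof -
  have sub: "D1 \<subseteq> vertices G1 \<times> vertices G1" "D2 \<subseteq> vertices G2 \<times> vertices G2"
    using orientation_subset simple1 simple2 D1 D2 by blast+
  have away: "indegree D1 v = outdegree D1 v" if "v \<in> vertices G1 - {u}" for v
  proof -
    have "v \<notin> vertices G2" using that meet by auto
    then have "{w. (w, v) \<in> D2} = {}" "{w. (v, w) \<in> D2} = {}"
      using sub(2) by auto
    then show ?thesis
      using bal[of v] degrees_of_union[OF D1 D2, of v] that by simp
  qed
  have "finite (vertices G1)"
    using simple1 by (simp add: simple_graph_def)
  then have "indegree D1 u = outdegree D1 u"
    using sub(1) root_in(1) away by (rule balanced_at_last_vertex)
  then show ?thesis
    using away D1 by (auto simp: Eulerian_orientations_def)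
qed

lemma union_in_Eulerian_orientations_iff:
  assumes D1: "D1 \<in> orientations G1" and D2: "D2 \<in> orientations G2"
  shows "D1 \<union> D2 \<in> Eulerian_orientations (union_graph G1 G2)
    \<longleftrightarrow> D1 \<in> Eulerian_orientations G1 \<and> D2 \<in> Eulerian_orientations G2"
proof
  assume "D1 \<union> D2 \<in> Eulerian_orientations (union_graph G1 G2)"
  then have bal: "indegree (D1 \<union> D2) v = outdegree (D1 \<union> D2) v"
    if "v \<in> vertices G1 \<union> vertices G2" for v
    using that unfolding Eulerian_orientations_def union_graph_def by simp
  interpret swap: one_point_union G2 G1 u
    by (rule one_point_union_commute) unfold_locales
  show "D1 \<in> Eulerian_orientations G1 \<and> D2 \<in> Eulerian_orientations G2"
    using balanced_part1[OF D1 D2] swap.balanced_part1[OF D2 D1] bal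
    by (simp add: Un_commute)
next
  assume *: "D1 \<in> Eulerian_orientations G1 \<and> D2 \<in> Eulerian_orientations G2"
  have sub: "D1 \<subseteq> vertices G1 \<times> vertices G1" "D2 \<subseteq> vertices G2 \<times> vertices G2"
    using orientation_subset simple1 simple2 D1 D2 by blast+
  have "indegree D1 v = outdegree D1 v" for v
  proof (cases "v \<in> vertices G1")
    case False
    then have "{w. (w, v) \<in> D1} = {}" "{w. (v, w) \<in> D1} = {}" using sub by auto
    then show ?thesis by simp
  qed (use * in \<open>simp add: Eulerian_orientations_def\<close>)
  moreover have "indegree D2 v = outdegree D2 v" for v
  proof (cases "v \<in> vertices G2")
    case False
    then have "{w. (w, v) \<in> D2} = {}" "{w. (v, w) \<in> D2} = {}" using sub by auto
    then show ?thesis by simp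
  qed (use * in \<open>simp add: Eulerian_orientations_def\<close>)
  ultimately have "indegree (D1 \<union> D2) v = outdegree (D1 \<union> D2) v" for v
    using degrees_of_union[OF D1 D2, of v] by simp
  moreover have "D1 \<union> D2 \<in> orientations (union_graph G1 G2)"
    using D1 D2 by (subst union_in_orientations_iff) (auto simp: orientations_def)
  ultimately show "D1 \<union> D2 \<in> Eulerian_orientations (union_graph G1 G2)"
    by (simp add: Eulerian_orientations_def)
qed

lemma card_Eulerian_orientations_union:
  "card (Eulerian_orientations (union_graph G1 G2))
    = card (Eulerian_orientations G1) * card (Eulerian_orientations G2)"
proof -
  let ?S = "Eulerian_orientations G1 \<times> Eulerian_orientations G2"
  have ori: "D \<in> orientations G" if "D \<in> Eulerian_orientations G" for D and G :: "'a ugraph"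
    using that by (simp add: Eulerian_orientations_def)
  have arc: "{x, y} \<in> edges G" if "D \<in> orientations G" "(x, y) \<in> D" for x y D and G :: "'a ugraph"
    using that by (auto simp: orientations_def)
  have "Eulerian_orientations (union_graph G1 G2) = (\<lambda>(D1, D2). D1 \<union> D2) ` ?S"
  proof (intro equalityI subsetI)
    fix D assume D: "D \<in> Eulerian_orientations (union_graph G1 G2)"
    define D1 D2 where "D1 = {(x, y) \<in> D. {x, y} \<in> edges G1}"
      and "D2 = {(x, y) \<in> D. {x, y} \<in> edges G2}"
    have un: "D = D1 \<union> D2"
      using arc[OF ori[OF D]] by (auto simp: D1_def D2_def union_graph_def)
    have "{x, y} \<in> edges G1" if "(x, y) \<in> D1" for x y
      using that by (simp add: D1_def)
    moreover have "{x, y} \<in> edges G2" if "(x, y) \<in> D2" for x y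
      using that by (simp add: D2_def)
    ultimately have "D1 \<in> orientations G1 \<and> D2 \<in> orientations G2"
      using ori[OF D, unfolded un] union_in_orientations_iff[of D1 D2] by blast
    then have "D1 \<in> Eulerian_orientations G1" "D2 \<in> Eulerian_orientations G2"
      using D[unfolded un] union_in_Eulerian_orientations_iff[of D1 D2] by blast+
    then show "D \<in> (\<lambda>(D1, D2). D1 \<union> D2) ` ?S"
      by (intro image_eqI[of _ _ "(D1, D2)"]) (simp_all add: un)
  next
    fix D assume "D \<in> (\<lambda>(D1, D2). D1 \<union> D2) ` ?S"
    then obtain D1 D2 where "D = D1 \<union> D2"
      "D1 \<in> Eulerian_orientations G1" "D2 \<in> Eulerian_orientations G2"
      by auto
    then show "D \<in> Eulerian_orientations (union_graph G1 G2)"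
      using union_in_Eulerian_orientations_iff[of D1 D2] ori by simp
  qed
  moreover have "inj_on (\<lambda>(D1, D2). D1 \<union> D2) ?S"
  proof -
    have part1: "D1 = {(x, y) \<in> D1 \<union> D2. {x, y} \<in> edges G1}"
      and part2: "D2 = {(x, y) \<in> D1 \<union> D2. {x, y} \<in> edges G2}"
      if "D1 \<in> orientations G1" "D2 \<in> orientations G2" for D1 D2
      using arc[OF that(1)] arc[OF that(2)] edges_disjoint by blast+
    show ?thesis
    proof (rule inj_onI, clarify, intro conjI)
      fix D1 D2 D1' D2'
      assume *: "D1 \<in> Eulerian_orientations G1" "D2 \<in> Eulerian_orientations G2"
        "D1' \<in> Eulerian_orientations G1" "D2' \<in> Eulerian_orientations G2" "D1 \<union> D2 = D1' \<union> D2'"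
      show "D1 = D1'"
        using part1[OF *(1,2)[THEN ori]] part1[OF *(3,4)[THEN ori]]
        unfolding *(5) by (rule trans[OF _ sym])
      show "D2 = D2'"
        using part2[OF *(1,2)[THEN ori]] part2[OF *(3,4)[THEN ori]]
        unfolding *(5) by (rule trans[OF _ sym])
    qed
  qed
  ultimately show ?thesis
    by (simp add: card_image card_cartesian_product)
qed

end

section \<open>Isomorphic copies and neighbourhoods\<close>

definition map_graph :: "('a \<Rightarrow> 'b) \<Rightarrow> 'a ugraph \<Rightarrow> 'b ugraph" where
  "map_graph f G = \<lparr>vertices = f ` vertices G, edges = (`) f ` edges G\<rparr>"

lemma inj_image: "inj f \<Longrightarrow> inj ((`) f)"
  by (rule injI) (simp add: inj_image_eq_iff)

lemma image_edge_iff: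
  assumes "inj f"
  shows "{f x, f y} \<in> (`) f ` F \<longleftrightarrow> {x, y} \<in> F"
  using inj_image_mem_iff[OF inj_image[OF assms], of "{x, y}" F] by simp

text \<open>Injectivity is required on the whole type, so that images of edge sets and of arc sets
  are injective without side conditions.\<close>

locale graph_embedding =
  fixes f :: "'a \<Rightarrow> 'b" and G :: "'a ugraph"
  assumes inj: "inj f" and simple: "simple_graph G"
begin

lemma simple_map: "simple_graph (map_graph f G)"
  using simple inj
  by (auto simp: simple_graph_def map_graph_def card_image inj_on_subset[OF inj])

lemma joined_image_iff: "joined ((`) f ` F) (f x) (f y) \<longleftrightarrow> joined F x y"
proof
  assume "joined F x y"
  then show "joined ((`) f ` F) (f x) (f y)"
  proof (induction rule: rtranclp_induct)
    case (step y z)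
    then show ?case
      using image_edge_iff[OF inj, of y z F] by (simp add: rtranclp.rtrancl_into_rtrancl)
  qed simp
next
  \<comment> \<open>For the induction the end of the walk is arbitrary: every edge is an image, so
    the walk never leaves the range of \<open>f\<close>.\<close>
  have "\<exists>z. w = f z \<and> joined F x z" if "joined ((`) f ` F) (f x) w" for w
    using that
  proof (induction rule: rtranclp_induct)
    case (step v w)
    then obtain z where z: "v = f z" "joined F x z" by blast
    have "w \<in> range f"
      using step.hyps(2) by blast
    then obtain z' where "w = f z'" by blast
    then show ?case
      using z step.hyps(2) image_edge_iff[OF inj, of z z' F]
      by (intro exI[of _ z']) (simp add: rtranclp.rtrancl_into_rtrancl)
  qed blast
  moreover assume "joined ((`) f ` F) (f x) (f y)"
  ultimately show "joined F x y"
    using injD[OF inj] by metis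
qed

lemma spans_image_iff: "spans (f ` V) ((`) f ` F) \<longleftrightarrow> spans V F"
  by (simp add: spans_iff joined_image_iff)

lemma connected_map: "connected_graph (map_graph f G) \<longleftrightarrow> connected_graph G"
  using spans_image_iff[of "vertices G" "edges G"] by (simp add: map_graph_def spans_graph)

lemma card_vertices_map: "card (vertices (map_graph f G)) = card (vertices G)"
  using inj by (simp add: map_graph_def card_image inj_on_subset)

lemma inj_image_f: "inj ((`) f)"
  using inj by (simp add: inj_image)

lemma degree_map: "degree_of (map_graph f G) (f v) = degree_of G v"
proof -
  have "{e \<in> edges (map_graph f G). f v \<in> e} = (`) f ` {e \<in> edges G. v \<in> e}"
    using injD[OF inj] by (auto simp: map_graph_def)
  then show ?thesis
    using inj_image_f by (simp add: degree_of_def card_image inj_on_subset)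
qed

text \<open>Minimal connectivity is transported because both \<open>spans\<close> and the removal of
  an edge commute with the image.\<close>

lemma spanning_trees_map: "spanning_trees (map_graph f G) = (`) ((`) f) ` spanning_trees G"
proof -
  have remove: "(`) f ` F - {f ` e} = (`) f ` (F - {e})" for F e
    using image_set_diff[OF inj_image_f, of F "{e}"] by simp
  have "(`) f ` F \<in> spanning_trees (map_graph f G) \<longleftrightarrow> F \<in> spanning_trees G" for F
    unfolding spanning_trees_eq_minimal[OF simple] spanning_trees_eq_minimal[OF simple_map]
    using inj_image_subset_iff[OF inj_image_f, of F "edges G"]
    by (simp add: map_graph_def spans_image_iff remove)
  moreover have "\<exists>F. F' = (`) f ` F" if "F' \<in> spanning_trees (map_graph f G)" for F'
    using that by (auto simp: spanning_trees_def map_graph_def subset_image_iff)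
  ultimately show ?thesis by blast
qed

lemma card_spanning_trees_map:
  "card (spanning_trees (map_graph f G)) = card (spanning_trees G)"
proof -
  have "inj ((`) ((`) f))"
    using inj_image_f by (simp add: inj_image)
  then show ?thesis
    by (simp add: spanning_trees_map card_image inj_on_subset)
qed

lemma mem_map_prod_iff: "(f x, f y) \<in> map_prod f f ` D \<longleftrightarrow> (x, y) \<in> D"
  using inj_image_mem_iff[OF prod.inj_map[OF inj inj], of "(x, y)" D] by simp

lemma orientations_map: "orientations (map_graph f G) = (`) (map_prod f f) ` orientations G"
proof -
  have range: "u \<in> range f \<and> v \<in> range f" if "{u, v} \<in> edges (map_graph f G)" for u v
  proof -
    have "{u, v} \<subseteq> range f"
      using that by (auto simp: map_graph_def)
    then show ?thesis by simp
  qed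
  have "map_prod f f ` D \<in> orientations (map_graph f G) \<longleftrightarrow> D \<in> orientations G" for D
  proof
    assume *: "map_prod f f ` D \<in> orientations (map_graph f G)"
    show "D \<in> orientations G"
      unfolding orientations_def
    proof (intro CollectI conjI ballI allI impI)
      fix p assume "p \<in> D"
      then have "(f (fst p), f (snd p)) \<in> map_prod f f ` D"
        by (simp add: mem_map_prod_iff)
      then have "{f (fst p), f (snd p)} \<in> edges (map_graph f G)"
        using * by (auto simp: orientations_def)
      then show "case p of (u, v) \<Rightarrow> {u, v} \<in> edges G"
        by (simp add: map_graph_def image_edge_iff[OF inj] split_beta)
    next
      fix x y assume "{x, y} \<in> edges G"
      then have "{f x, f y} \<in> edges (map_graph f G)"
        by (simp add: map_graph_def image_edge_iff[OF inj])
      then have "(f x, f y) \<in> map_prod f f ` D \<longleftrightarrow> (f y, f x) \<notin> map_prod f f ` D"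
        using * by (simp add: orientations_def)
      then show "(x, y) \<in> D \<longleftrightarrow> (y, x) \<notin> D"
        by (simp add: mem_map_prod_iff)
    qed
  next
    assume *: "D \<in> orientations G"
    show "map_prod f f ` D \<in> orientations (map_graph f G)"
      unfolding orientations_def
    proof (intro CollectI conjI ballI allI impI)
      fix p assume "p \<in> map_prod f f ` D"
      then obtain x y where "p = (f x, f y)" "(x, y) \<in> D" by auto
      moreover from \<open>(x, y) \<in> D\<close> have "{x, y} \<in> edges G"
        using * by (auto simp: orientations_def)
      ultimately show "case p of (u, v) \<Rightarrow> {u, v} \<in> edges (map_graph f G)"
        by (simp add: map_graph_def image_edge_iff[OF inj])
    next
      fix u v assume uv: "{u, v} \<in> edges (map_graph f G)"
      then obtain x y where xy: "u = f x" "v = f y"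
        using range by blast
      then have "{x, y} \<in> edges G"
        using uv by (simp add: map_graph_def image_edge_iff[OF inj])
      then show "(u, v) \<in> map_prod f f ` D \<longleftrightarrow> (v, u) \<notin> map_prod f f ` D"
        using * by (simp add: xy mem_map_prod_iff orientations_def)
    qed
  qed
  moreover have "\<exists>D. D' = map_prod f f ` D" if "D' \<in> orientations (map_graph f G)" for D'
  proof -
    have "D' \<subseteq> range (map_prod f f)"
    proof (rule subrelI)
      fix u v assume "(u, v) \<in> D'"
      then have "{u, v} \<in> edges (map_graph f G)"
        using that by (auto simp: orientations_def)
      then obtain x y where "u = f x" "v = f y"
        using range by blast
      then show "(u, v) \<in> range (map_prod f f)"
        by (intro range_eqI[of _ _ "(x, y)"]) simp
    qed
    then show ?thesis
      by (auto simp: subset_image_iff)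
  qed
  ultimately show ?thesis by blast
qed

lemma Eulerian_orientations_map:
  "Eulerian_orientations (map_graph f G) = (`) (map_prod f f) ` Eulerian_orientations G"
proof -
  have nbrs: "{w. (w, f v) \<in> map_prod f f ` D} = f ` {w. (w, v) \<in> D}"
    "{w. (f v, w) \<in> map_prod f f ` D} = f ` {w. (v, w) \<in> D}" for v D
    using injD[OF inj] by auto
  have "(\<forall>v\<in>vertices (map_graph f G).
        indegree (map_prod f f ` D) v = outdegree (map_prod f f ` D) v)
      \<longleftrightarrow> (\<forall>v\<in>vertices G. indegree D v = outdegree D v)" for D
    by (simp add: map_graph_def nbrs card_image inj_on_subset[OF inj])
  then show ?thesis
    unfolding Eulerian_orientations_def orientations_map by blast
qed

lemma card_Eulerian_orientations_map:
  "card (Eulerian_orientations (map_graph f G)) = card (Eulerian_orientations G)"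
proof -
  have "inj ((`) (map_prod f f))"
    using prod.inj_map[OF inj inj] by (simp add: inj_image)
  then show ?thesis
    by (simp add: Eulerian_orientations_map card_image inj_on_subset)
qed

end

section \<open>Degree and balance in terms of neighbours\<close>

lemma degree_eq_card_neighbours:
  assumes "simple_graph G"
  shows "degree_of G v = card {w. {v, w} \<in> edges G}"
proof -
  have "{e \<in> edges G. v \<in> e} = (\<lambda>w. {v, w}) ` {w. {v, w} \<in> edges G}"
  proof (intro equalityI subsetI)
    fix e assume e: "e \<in> {e \<in> edges G. v \<in> e}"
    then have "card e = 2"
      using assms by (simp add: simple_graph_def)
    then obtain x y where "e = {x, y}"
      by (meson card_2_iff)
    then have "e = {v, if x = v then y else x}"
      using e by auto
    then show "e \<in> (\<lambda>w. {v, w}) ` {w. {v, w} \<in> edges G}"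
      using e by blast
  qed auto
  moreover have "inj_on (\<lambda>w. {v, w}) {w. {v, w} \<in> edges G}"
    by (auto simp: inj_on_def doubleton_eq_iff)
  ultimately show ?thesis
    by (simp add: degree_of_def card_image)
qed

lemma orientation_arc: "D \<in> orientations G \<Longrightarrow> (x, y) \<in> D \<Longrightarrow> {x, y} \<in> edges G"
  by (auto simp: orientations_def)

lemma finite_neighbours: "simple_graph G \<Longrightarrow> finite {w. {v, w} \<in> edges G}"
  by (rule finite_subset[of _ "vertices G"]) (auto simp: simple_graph_def)

text \<open>An orientation splits the neighbours of a vertex into in- and out-neighbours, so balance
  becomes a condition on out-degrees alone: one equation per vertex.\<close>

lemma Eulerian_orientation_iff:
  assumes "simple_graph G" "D \<in> orientations G"
  shows "D \<in> Eulerian_orientations G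
    \<longleftrightarrow> (\<forall>v\<in>vertices G. 2 * outdegree D v = card {w. {v, w} \<in> edges G})"
proof -
  have "indegree D v = outdegree D v \<longleftrightarrow> 2 * outdegree D v = card {w. {v, w} \<in> edges G}" for v
  proof -
    have arc: "{v, w} \<in> edges G" if "(v, w) \<in> D \<or> (w, v) \<in> D" for w
      using orientation_arc[OF assms(2), of v w] orientation_arc[OF assms(2), of w v] that
      by (metis insert_commute)
    have flip: "(v, w) \<in> D \<longleftrightarrow> (w, v) \<notin> D" if "{v, w} \<in> edges G" for w
      using assms(2) that by (simp add: orientations_def)
    have "{w. {v, w} \<in> edges G} = {w. (w, v) \<in> D} \<union> {w. (v, w) \<in> D}"
      using arc flip by blast
    moreover have "{w. (w, v) \<in> D} \<inter> {w. (v, w) \<in> D} = {}"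
      using arc flip by blast
    moreover from calculation(1) have "finite {w. (w, v) \<in> D}" "finite {w. (v, w) \<in> D}"
      using finite_neighbours[OF assms(1), of v] by simp_all
    ultimately have "card {w. {v, w} \<in> edges G} = indegree D v + outdegree D v"
      by (simp add: card_Un_disjoint)
    then show ?thesis by linarith
  qed
  then show ?thesis
    using assms(2) by (simp add: Eulerian_orientations_def)
qed

lemma converse_Eulerian_orientation:
  assumes "D \<in> Eulerian_orientations G"
  shows "D\<inverse> \<in> Eulerian_orientations G"
proof -
  have D: "D \<in> orientations G" "\<forall>v\<in>vertices G. indegree D v = outdegree D v"
    using assms by (simp_all add: Eulerian_orientations_def)
  have "D\<inverse> \<in> orientations G"
    unfolding orientations_def
  proof (intro CollectI conjI ballI allI impI)
    fix p assume "p \<in> D\<inverse>"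
    then have "(snd p, fst p) \<in> D" by auto
    then have "{fst p, snd p} \<in> edges G"
      using orientation_arc[OF D(1)] by (metis insert_commute)
    then show "case p of (u, v) \<Rightarrow> {u, v} \<in> edges G"
      by (simp add: split_beta)
  next
    fix x y assume "{x, y} \<in> edges G"
    then have "(x, y) \<in> D \<longleftrightarrow> (y, x) \<notin> D"
      using D(1) by (simp add: orientations_def)
    then show "(x, y) \<in> D\<inverse> \<longleftrightarrow> (y, x) \<notin> D\<inverse>"
      by auto
  qed
  then show ?thesis
    using D(2) by (simp add: Eulerian_orientations_def)
qed

section \<open>Cycles\<close>

locale cycle_graph =
  fixes k :: nat
  assumes k: "k \<ge> 3"
begin

definition succ :: "nat \<Rightarrow> nat" where
  "succ i = (if Suc i = k then 0 else Suc i)"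

definition link :: "nat \<Rightarrow> nat set" where
  "link i = {i, succ i}"

definition C :: "nat ugraph" where
  "C = \<lparr>vertices = {..<k}, edges = link ` {..<k}\<rparr>"

lemma succ_less: "i < k \<Longrightarrow> succ i < k"
  by (auto simp: succ_def)

lemma succ_ne: "i < k \<Longrightarrow> succ i \<noteq> i"
  using k by (auto simp: succ_def)

lemma succ_succ_ne: "i < k \<Longrightarrow> succ (succ i) \<noteq> i"
  using k by (auto simp: succ_def split: if_splits)

lemma succ_inject: "i < k \<Longrightarrow> j < k \<Longrightarrow> succ i = succ j \<longleftrightarrow> i = j"
  by (auto simp: succ_def)

lemma succ_surj:
  assumes "v < k"
  obtains i where "i < k" "v = succ i"
proof (cases v)
  case 0
  then show ?thesis using that[of "k - 1"] k by (simp add: succ_def)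
next
  case (Suc i)
  then show ?thesis using that[of i] assms by (simp add: succ_def)
qed

lemma link_inject: "i < k \<Longrightarrow> j < k \<Longrightarrow> link i = link j \<longleftrightarrow> i = j"
  using succ_succ_ne by (auto simp: link_def doubleton_eq_iff)

lemma edges_C: "edges C = link ` {..<k}" and vertices_C: "vertices C = {..<k}"
  by (simp_all add: C_def)

lemma edge_iff: "{x, y} \<in> edges C \<longleftrightarrow> x < k \<and> y = succ x \<or> y < k \<and> x = succ y"
  by (auto simp: edges_C link_def doubleton_eq_iff)

lemma simple_C: "simple_graph C"
  using succ_less succ_ne by (auto simp: simple_graph_def edges_C vertices_C link_def card_2_iff)

text \<open>Stated at \<open>succ i\<close>, so that the predecessor is available without a name of
  its own; \<open>succ_surj\<close> reaches every vertex.\<close>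

lemma neighbours:
  assumes "i < k"
  shows "{w. {succ i, w} \<in> edges C} = {i, succ (succ i)}"
  using assms succ_inject succ_less by (auto simp: edge_iff)

lemma degree_C:
  assumes "v < k"
  shows "degree_of C v = 2"
proof -
  obtain i where "i < k" "v = succ i"
    using assms by (rule succ_surj)
  then show ?thesis
    using succ_succ_ne[of i] by (simp add: degree_eq_card_neighbours[OF simple_C] neighbours eq_commute)
qed

text \<open>The opened cycle is a path: vertices up to \<open>i\<close> are reached by climbing from
  0, the others by descending from \<open>k - 1\<close>, which is next to 0.\<close>

lemma spans_minus_link:
  assumes "i < k"
  shows "spans {..<k} (edges C - {link i})"
proof -
  let ?F = "edges C - {link i}"
  have link: "link m \<in> ?F" if "m < k" "m \<noteq> i" for m
    using that assms by (auto simp: edges_C link_inject)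
  have low: "joined ?F 0 m" if "m \<le> i" for m
    using that
  proof (induction m)
    case (Suc m)
    then have "{m, Suc m} \<in> ?F"
      using link[of m] assms by (simp add: link_def succ_def)
    then show ?case
      using Suc by (simp add: rtranclp.rtrancl_into_rtrancl)
  qed simp
  have high: "joined ?F (k - 1) m" if "m \<le> k - 1" "i < m" for m
    using that
  proof (induction m rule: inc_induct)
    case (step m)
    then have "link m = {Suc m, m}"
      by (auto simp: link_def succ_def)
    then have "{Suc m, m} \<in> ?F"
      using link[of m] step by simp
    then show ?case
      using step by (simp add: rtranclp.rtrancl_into_rtrancl)
  qed simp
  show ?thesis
  proof (rule spans_if_joined_root)
    show "0 \<in> {..<k}" using k by simp
    fix v assume v: "v \<in> {..<k}"
    show "joined ?F 0 v"
    proof (cases "v \<le> i")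
      case False
      \<comment> \<open>A vertex above \<open>i\<close> exists, so \<open>i\<close> is not
        \<open>k - 1\<close> and the wrap-around link has survived.\<close>
      then have "{0, k - 1} \<in> ?F"
        using link[of "k - 1"] v k by (simp add: link_def succ_def insert_commute)
      then show ?thesis
        using high[of v] False v by (simp add: converse_rtranclp_into_rtranclp)
    qed (rule low)
  qed
qed

text \<open>The links at \<open>i\<close> and \<open>j\<close> are the only ones crossing the
  boundary of the segment \<open>{i<..j}\<close>, so without them \<open>j\<close> cannot reach
  \<open>i\<close>.\<close>

lemma not_spans_minus_two_links:
  assumes "i < j" "j < k" "F \<subseteq> edges C - {link i, link j}"
  shows "\<not> spans {..<k} F"
proof
  have closed: "y \<in> {i<..j}" if xy: "x \<in> {i<..j}" "{x, y} \<in> F" for x y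
  proof -
    obtain m where "m < k" "{x, y} = {m, succ m}" "m \<noteq> i" "m \<noteq> j"
    proof -
      have "{x, y} \<in> edges C" "{x, y} \<noteq> link i" "{x, y} \<noteq> link j"
        using xy(2) assms(3) by auto
      then show ?thesis
        using that unfolding edges_C by (metis imageE lessThan_iff link_def)
    qed
    then show ?thesis
      using xy(1) assms(1,2) by (auto simp: doubleton_eq_iff succ_def split: if_splits)
  qed
  have "y \<in> {i<..j}" if "joined F j y" for y
    using that
  proof (induction rule: rtranclp_induct)
    case base
    show ?case using assms(1) by simp
  next
    case (step y z)
    show ?case using closed[OF step.IH step.hyps(2)] .
  qed
  moreover assume "spans {..<k} F"
  then have "joined F j i"
    using assms(1,2) by (simp add: spans_iff)
  ultimately have "i \<in> {i<..j}"
    by blast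
  then show False by simp
qed

lemma connected_C: "connected_graph C"
  using spans_mono[OF _ spans_minus_link[of 0], of "edges C"] k spans_graph[of C]
  by (simp add: vertices_C)

lemma spanning_trees_C: "spanning_trees C = (\<lambda>i. edges C - {link i}) ` {..<k}"
proof -
  have two: "\<not> spans {..<k} F" if "i \<noteq> j" "i < k" "j < k" "F \<subseteq> edges C - {link i, link j}" for i j F
    using not_spans_minus_two_links[of i j F] not_spans_minus_two_links[of j i F] that
    by (cases "i < j") (auto simp: insert_commute)
  show ?thesis
    unfolding spanning_trees_eq_minimal[OF simple_C] vertices_C
  proof (intro equalityI subsetI)
    fix F assume "F \<in> {F. F \<subseteq> edges C \<and> spans {..<k} F \<and> (\<forall>e\<in>F. \<not> spans {..<k} (F - {e}))}"
    then have F: "F \<subseteq> edges C" "spans {..<k} F" "\<And>e. e \<in> F \<Longrightarrow> \<not> spans {..<k} (F - {e})"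
      by auto
    \<comment> \<open>The whole cycle is not minimal, and missing two links disconnects it; exactly
      one link is missing.\<close>
    have "F \<noteq> edges C"
      using F(3)[of "link 0"] spans_minus_link[of 0] k by (auto simp: edges_C)
    then obtain i where i: "i < k" "link i \<notin> F"
      using F(1) by (auto simp: edges_C)
    have "link j \<in> F" if "j < k" "j \<noteq> i" for j
      using two[of i j F] that i F(1,2) by blast
    then have "F = edges C - {link i}"
      using i F(1) by (auto simp: edges_C)
    then show "F \<in> (\<lambda>i. edges C - {link i}) ` {..<k}"
      using i(1) by blast
  next
    fix F assume "F \<in> (\<lambda>i. edges C - {link i}) ` {..<k}"
    then obtain i where i: "i < k" "F = edges C - {link i}" by auto
    have "\<not> spans {..<k} (F - {e})" if "e \<in> F" for e
    proof -
      obtain j where j: "j < k" "e = link j" "e \<noteq> link i"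
        using \<open>e \<in> F\<close> i(2) by (auto simp: edges_C)
      then have "j \<noteq> i" by auto
      moreover have "F - {e} \<subseteq> edges C - {link i, link j}"
        using i(2) j(2) by auto
      ultimately show ?thesis
        using two[of i j "F - {e}"] i(1) j(1) by simp
    qed
    then show "F \<in> {F. F \<subseteq> edges C \<and> spans {..<k} F \<and> (\<forall>e\<in>F. \<not> spans {..<k} (F - {e}))}"
      using spans_minus_link[OF i(1)] i(2) by blast
  qed
qed

lemma card_spanning_trees_C: "card (spanning_trees C) = k"
proof -
  have "inj_on (\<lambda>i. edges C - {link i}) {..<k}"
  proof (rule inj_onI)
    fix i j assume ij: "i \<in> {..<k}" "j \<in> {..<k}" "edges C - {link i} = edges C - {link j}"
    have "link i \<in> edges C" "link j \<in> edges C"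
      using ij(1,2) by (simp_all add: edges_C)
    then have "link i = link j"
      using ij(3) by blast
    then show "i = j"
      using ij link_inject by simp
  qed
  then show ?thesis
    by (simp add: spanning_trees_C card_image)
qed

section \<open>Eulerian orientations of a cycle\<close>

definition clockwise :: "(nat \<times> nat) set" where
  "clockwise = (\<lambda>i. (i, succ i)) ` {..<k}"

lemma mem_clockwise_iff: "(x, y) \<in> clockwise \<longleftrightarrow> x < k \<and> y = succ x"
  by (auto simp: clockwise_def)

lemma clockwise_Eulerian: "clockwise \<in> Eulerian_orientations C"
proof -
  have ori: "clockwise \<in> orientations C"
    unfolding orientations_def
  proof (intro CollectI conjI ballI allI impI)
    fix x y assume "{x, y} \<in> edges C"
    then consider "x < k" "y = succ x" | "y < k" "x = succ y"
      by (auto simp: edge_iff)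
    then show "(x, y) \<in> clockwise \<longleftrightarrow> (y, x) \<notin> clockwise"
      by cases (use succ_succ_ne mem_clockwise_iff in metis)+
  qed (auto simp: mem_clockwise_iff edge_iff)
  have "2 * outdegree clockwise v = card {w. {v, w} \<in> edges C}" if "v < k" for v
  proof -
    have "{w. (v, w) \<in> clockwise} = {succ v}"
      using that by (auto simp: mem_clockwise_iff)
    then show ?thesis
      using degree_C[OF that] by (simp add: degree_eq_card_neighbours[OF simple_C])
  qed
  then show ?thesis
    using Eulerian_orientation_iff[OF simple_C ori] by (simp add: vertices_C)
qed

text \<open>Each vertex has exactly one outgoing arc, so the direction of one link forces that of
  the next; the link at 0 decides everything.\<close>

lemma Eulerian_orientations_C: "Eulerian_orientations C = {clockwise, clockwise\<inverse>}"
proof (intro equalityI subsetI)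
  fix D assume D: "D \<in> Eulerian_orientations C"
  then have ori: "D \<in> orientations C"
    by (simp add: Eulerian_orientations_def)
  then have flip: "(x, y) \<in> D \<longleftrightarrow> (y, x) \<notin> D" if "{x, y} \<in> edges C" for x y
    using that by (simp add: orientations_def)
  have arc: "{x, y} \<in> edges C" if "(x, y) \<in> D" for x y
    using ori that by (auto simp: orientations_def)
  have forward: "(i, succ i) \<in> D \<longleftrightarrow> (succ i, succ (succ i)) \<in> D" if "i < k" for i
  proof -
    have ne: "i \<noteq> succ (succ i)"
      using succ_succ_ne[OF that] by simp
    have "2 * outdegree D (succ i) = card {i, succ (succ i)}"
      using D neighbours[OF that] succ_less[OF that]
      by (simp add: Eulerian_orientation_iff[OF simple_C ori] vertices_C)
    then have one: "outdegree D (succ i) = 1"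
      using ne by simp
    have sub: "{w. (succ i, w) \<in> D} \<subseteq> {i, succ (succ i)}"
      using arc neighbours[OF that] by blast
    have "\<not> ((succ i, i) \<in> D \<and> (succ i, succ (succ i)) \<in> D)"
    proof
      assume "(succ i, i) \<in> D \<and> (succ i, succ (succ i)) \<in> D"
      then have "{w. (succ i, w) \<in> D} = {i, succ (succ i)}"
        using sub by auto
      then show False using one ne by simp
    qed
    moreover have "(succ i, i) \<in> D \<or> (succ i, succ (succ i)) \<in> D"
    proof (rule ccontr)
      assume "\<not> ?thesis"
      then have "{w. (succ i, w) \<in> D} = {}"
        using sub by auto
      then show False using one by simp
    qed
    moreover have "(i, succ i) \<in> D \<longleftrightarrow> (succ i, i) \<notin> D"
      using that by (intro flip) (simp add: edge_iff)
    ultimately show ?thesis by blast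
  qed
  have const: "(i, succ i) \<in> D \<longleftrightarrow> (0, succ 0) \<in> D" if "i < k" for i
    using that
  proof (induction i)
    case (Suc i)
    then have "succ i = Suc i" "i < k"
      by (simp_all add: succ_def)
    then show ?case
      using Suc.IH forward[of i] by simp
  qed simp
  show "D \<in> {clockwise, clockwise\<inverse>}"
  proof (cases "(0, succ 0) \<in> D")
    case True
    then have cw: "(i, succ i) \<in> D \<and> (succ i, i) \<notin> D" if "i < k" for i
      using const[OF that] flip[of i "succ i"] that by (simp add: edge_iff)
    have "D = clockwise"
    proof (intro equalityI subrelI)
      fix x y assume xy: "(x, y) \<in> D"
      then show "(x, y) \<in> clockwise"
        using arc[OF xy] cw by (auto simp: edge_iff mem_clockwise_iff)
    qed (use cw in \<open>auto simp: mem_clockwise_iff\<close>)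
    then show ?thesis by simp
  next
    case False
    then have ccw: "(i, succ i) \<notin> D \<and> (succ i, i) \<in> D" if "i < k" for i
      using const[OF that] flip[of i "succ i"] that by (simp add: edge_iff)
    have "D = clockwise\<inverse>"
    proof (intro equalityI subrelI)
      fix x y assume xy: "(x, y) \<in> D"
      then show "(x, y) \<in> clockwise\<inverse>"
        using arc[OF xy] ccw by (auto simp: edge_iff mem_clockwise_iff)
    qed (use ccw in \<open>auto simp: mem_clockwise_iff\<close>)
    then show ?thesis by simp
  qed
next
  fix D assume "D \<in> {clockwise, clockwise\<inverse>}"
  then show "D \<in> Eulerian_orientations C"
    using clockwise_Eulerian converse_Eulerian_orientation by blast
qed

lemma card_Eulerian_orientations_C: "card (Eulerian_orientations C) = 2"
proof -
  have "(0, succ 0) \<in> clockwise"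
    using k by (simp add: mem_clockwise_iff)
  \<comment> \<open>Here \<open>k \<ge> 3\<close> matters: on two vertices both directions would
    give the same arc set.\<close>
  moreover have "(0, succ 0) \<notin> clockwise\<inverse>"
    using k by (auto simp: mem_clockwise_iff succ_def split: if_splits)
  ultimately have "clockwise \<noteq> clockwise\<inverse>" by blast
  then show ?thesis
    by (simp add: Eulerian_orientations_C)
qed

end

section \<open>The leaf block\<close>

text \<open>The complete graph on \<open>{0, \<dots>, 4}\<close> with its edge \<open>{0, 1}\<close> subdivided by the vertex 5,
  listed along an Eulerian circuit.\<close>

definition leaf_arcs :: "(nat \<times> nat) set" where
  "leaf_arcs =
    {(0, 5), (5, 1), (1, 2), (2, 0), (0, 3), (3, 1), (1, 4), (4, 0), (2, 3), (3, 4), (4, 2)}"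

definition leaf :: "nat ugraph" where
  "leaf = \<lparr>vertices = {0, 1, 2, 3, 4, 5}, edges = (\<lambda>(x, y). {x, y}) ` leaf_arcs\<rparr>"

lemma vertices_leaf: "vertices leaf = {0, 1, 2, 3, 4, 5}"
  by (simp add: leaf_def)

lemma edge_leaf_iff: "{x, y} \<in> edges leaf \<longleftrightarrow> (x, y) \<in> leaf_arcs \<or> (y, x) \<in> leaf_arcs"
  by (auto simp: leaf_def doubleton_eq_iff)

lemma simple_leaf: "simple_graph leaf"
  by (simp add: simple_graph_def leaf_def leaf_arcs_def)

lemma neighbours_leaf:
  "{w. {0, w} \<in> edges leaf} = {2, 3, 4, 5}"
  "{w. {1, w} \<in> edges leaf} = {2, 3, 4, 5}"
  "{w. {2, w} \<in> edges leaf} = {0, 1, 3, 4}"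
  "{w. {3, w} \<in> edges leaf} = {0, 1, 2, 4}"
  "{w. {4, w} \<in> edges leaf} = {0, 1, 2, 3}"
  "{w. {5, w} \<in> edges leaf} = {0, 1}"
  by (simp_all add: edge_leaf_iff leaf_arcs_def set_eq_iff, safe)

lemma connected_leaf: "connected_graph leaf"
proof -
  have direct: "joined (edges leaf) 0 v" if "v \<in> {2, 3, 4, 5}" for v
  proof -
    have "{0, v} \<in> edges leaf"
      using that neighbours_leaf(1) by blast
    then show ?thesis by (rule r_into_rtranclp)
  qed
  have "{2, 1} \<in> edges leaf"
    by (simp add: edge_leaf_iff leaf_arcs_def)
  with direct[of 2] have "joined (edges leaf) 0 1"
    by (intro rtranclp.rtrancl_into_rtrancl[of _ 0 2 1]) simp_all
  then have "joined (edges leaf) 0 v" if "v \<in> vertices leaf" for v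
    using direct[of v] that by (auto simp: vertices_leaf)
  then have "spans (vertices leaf) (edges leaf)"
    by (intro spans_if_joined_root[of 0]) (simp_all add: vertices_leaf)
  then show ?thesis
    by (simp only: spans_graph)
qed

lemma degree_leaf:
  "degree_of leaf 0 = 4" "degree_of leaf 1 = 4" "degree_of leaf 2 = 4" "degree_of leaf 3 = 4"
  "degree_of leaf 4 = 4" "degree_of leaf 5 = 2"
  unfolding degree_eq_card_neighbours[OF simple_leaf] neighbours_leaf by simp_all

text \<open>Balance as linear equations between 0-1 indicators. In each sum the arc that is to be
  determined from the others stands last, as \<open>of_bool_cancel_last\<close> and
  \<open>of_bool_cancel_last2\<close> expect.\<close>

lemma Eulerian_leaf:
  fixes D
  defines "b \<equiv> \<lambda>x y. of_bool ((x, y) \<in> D) :: nat"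
  assumes "D \<in> Eulerian_orientations leaf"
  shows "b 1 2 + b 1 3 + b 1 4 + b 1 5 = 2" "b 2 1 + b 2 3 + b 2 4 + b 2 0 = 2"
    "b 3 1 + b 3 2 + b 3 4 + b 3 0 = 2" "b 4 1 + b 4 2 + b 4 3 + b 4 0 = 2" "b 5 1 + b 5 0 = 1"
proof -
  have ori: "D \<in> orientations leaf"
    using assms(2) by (simp add: Eulerian_orientations_def)
  have out: "2 * (\<Sum>w\<in>{w. {v, w} \<in> edges leaf}. b v w) = card {w. {v, w} \<in> edges leaf}"
    if "v \<in> vertices leaf" for v
  proof -
    have "{w. {v, w} \<in> edges leaf} \<inter> {w. (v, w) \<in> D} = {w. (v, w) \<in> D}"
      using orientation_arc[OF ori] by blast
    then have "(\<Sum>w\<in>{w. {v, w} \<in> edges leaf}. b v w) = outdegree D v"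
      unfolding b_def using finite_neighbours[OF simple_leaf, of v] by simp
    then show ?thesis
      using assms(2) that unfolding Eulerian_orientation_iff[OF simple_leaf ori] by simp
  qed
  have verts: "1 \<in> vertices leaf" "2 \<in> vertices leaf" "3 \<in> vertices leaf" "4 \<in> vertices leaf"
    "5 \<in> vertices leaf"
    by (simp_all add: vertices_leaf)
  show "b 1 2 + b 1 3 + b 1 4 + b 1 5 = 2" "b 2 1 + b 2 3 + b 2 4 + b 2 0 = 2"
    "b 3 1 + b 3 2 + b 3 4 + b 3 0 = 2" "b 4 1 + b 4 2 + b 4 3 + b 4 0 = 2" "b 5 1 + b 5 0 = 1"
    using verts[THEN out, unfolded neighbours_leaf] by simp_all
qed

lemma of_bool_cancel_last:
  assumes "of_bool a + of_bool b + of_bool c + of_bool d = (2 :: nat)"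
    "of_bool a' + of_bool b' + of_bool c' + of_bool d' = (2 :: nat)"
    "a = a'" "b = b'" "c = c'"
  shows "d = d'"
  using assms by (cases d; cases d') simp_all

lemma of_bool_cancel_last2:
  assumes "of_bool a + of_bool b = (1 :: nat)" "of_bool a' + of_bool b' = (1 :: nat)" "a = a'"
  shows "b = b'"
  using assms by (cases b; cases b') simp_all

definition inner_arcs :: "(nat \<times> nat) set" where
  "inner_arcs = {(1, 2), (3, 1), (1, 4), (2, 3), (3, 4), (4, 2)}"

text \<open>The other five edges of the leaf form a spanning tree, so that balance determines their
  orientation from the inner arcs.\<close>

lemma inj_on_inner_arcs: "inj_on (\<lambda>D. D \<inter> inner_arcs) (Eulerian_orientations leaf)"
proof (rule inj_onI)
  fix D D'
  assume D: "D \<in> Eulerian_orientations leaf" and D': "D' \<in> Eulerian_orientations leaf"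
    and eq: "D \<inter> inner_arcs = D' \<inter> inner_arcs"
  define same where "same x y \<longleftrightarrow> ((x, y) \<in> D) = ((x, y) \<in> D')" for x y
  have ori: "D \<in> orientations leaf" "D' \<in> orientations leaf"
    using D D' by (simp_all add: Eulerian_orientations_def)
  have flip: "same y x" if "same x y" "(x, y) \<in> leaf_arcs \<or> (y, x) \<in> leaf_arcs" for x y
  proof -
    have "{x, y} \<in> edges leaf"
      using that(2) by (simp only: edge_leaf_iff)
    then show ?thesis
      using that(1) ori unfolding orientations_def same_def by blast
  qed
  have inner: "same x y" if "(x, y) \<in> inner_arcs" for x y
    using eq that unfolding same_def by blast
  have in1: "same 1 2" "same 3 1" "same 1 4" "same 2 3" "same 3 4" "same 4 2"
    by (rule inner, simp add: inner_arcs_def)+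
  have in2: "same 2 1" "same 1 3" "same 4 1" "same 3 2" "same 4 3" "same 2 4"
    by (rule flip, rule in1, simp add: leaf_arcs_def)+
  note bal = Eulerian_leaf[OF D] and bal' = Eulerian_leaf[OF D']
  \<comment> \<open>The tree has the edges 1-5, 5-0, 0-2, 0-3, 0-4 and is peeled from its ends: at
    each of 1, 2, 3, 4 only one incident edge is still undetermined.\<close>
  have t1: "same 1 5"
    unfolding same_def using in1 in2 unfolding same_def by (intro of_bool_cancel_last[OF bal(1) bal'(1)])
  have t2: "same 2 0"
    unfolding same_def using in1 in2 unfolding same_def by (intro of_bool_cancel_last[OF bal(2) bal'(2)])
  have t3: "same 3 0"
    unfolding same_def using in1 in2 unfolding same_def by (intro of_bool_cancel_last[OF bal(3) bal'(3)])
  have t4: "same 4 0"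
    unfolding same_def using in1 in2 unfolding same_def by (intro of_bool_cancel_last[OF bal(4) bal'(4)])
  \<comment> \<open>With 1-5 known, the edge 5-0 is the only one left at 5.\<close>
  have t5: "same 5 1"
    by (rule flip, rule t1, simp add: leaf_arcs_def)
  then have t6: "same 5 0"
    unfolding same_def by (intro of_bool_cancel_last2[OF bal(5) bal'(5)])
  have t7: "same 0 5" "same 0 3"
    by (rule flip, rule t6 t3, simp add: leaf_arcs_def)+
  have "same x y" if "(x, y) \<in> leaf_arcs" for x y
    using that unfolding leaf_arcs_def
    by (simp only: insert_iff empty_iff prod.inject) (elim disjE conjE FalseE; simp only: in1 t2 t4 t5 t7)
  then have "same x y" if "{x, y} \<in> edges leaf" for x y
    using that flip[of y x] by (auto simp: edge_leaf_iff)
  then show "D = D'"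
    using orientation_arc[OF ori(1)] orientation_arc[OF ori(2)] unfolding same_def by auto
qed

text \<open>Restriction to the six inner edges is injective, which gives at most 64; one pattern
  that no Eulerian orientation induces makes the bound strict. Strictness is essential, since 64 is
  the degenerate value for the final argument.\<close>

lemma card_Eulerian_leaf_less: "card (Eulerian_orientations leaf) < 64"
proof -
  have fin: "finite inner_arcs" and card: "card inner_arcs = 6"
    by (simp_all add: inner_arcs_def)
  have "(\<lambda>D. D \<inter> inner_arcs) ` Eulerian_orientations leaf \<subseteq> Pow inner_arcs - {{(1, 2), (1, 4)}}"
  proof (intro image_subsetI DiffI)
    fix D assume D: "D \<in> Eulerian_orientations leaf"
    show "D \<inter> inner_arcs \<notin> {{(1, 2), (1, 4)}}"
    proof
      assume "D \<inter> inner_arcs \<in> {{(1, 2), (1, 4)}}"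
      \<comment> \<open>With this pattern the edge 1-3 also leaves 1, giving three outgoing arcs
        where balance allows two.\<close>
      then have *: "D \<inter> inner_arcs = {(1, 2), (1, 4)}" by simp
      have "(3, 1) \<in> inner_arcs" "(3, 1) \<notin> {(1, 2), (1, 4 :: nat)}"
        by (simp_all add: inner_arcs_def)
      then have "(3, 1) \<notin> D" using * by blast
      moreover have "{3, 1} \<in> edges leaf"
        by (simp add: edge_leaf_iff leaf_arcs_def)
      ultimately have "(1, 3) \<in> D"
        using D by (simp add: Eulerian_orientations_def orientations_def)
      moreover have "(1, 2) \<in> D" "(1, 4) \<in> D"
        using * by blast+
      ultimately show False
        using Eulerian_leaf(1)[OF D] by simp
    qed
  qed simp
  then have "card ((\<lambda>D. D \<inter> inner_arcs) ` Eulerian_orientations leaf)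
      \<le> card (Pow inner_arcs - {{(1, 2), (1, 4)}})"
    using fin by (intro card_mono) simp_all
  also have "\<dots> = card (Pow inner_arcs) - 1"
    using fin by (intro card_Diff_singleton) (simp add: inner_arcs_def)
  also have "\<dots> = 63"
    using fin card by (simp add: card_Pow)
  finally show ?thesis
    using card_image[OF inj_on_inner_arcs] by simp
qed

lemma leaf_arcs_Eulerian: "leaf_arcs \<in> Eulerian_orientations leaf"
proof -
  have "(y, x) \<notin> leaf_arcs" if "(x, y) \<in> leaf_arcs" for x y
    using that unfolding leaf_arcs_def insert_iff empty_iff prod.inject
    by (elim disjE conjE FalseE) simp_all
  then have "leaf_arcs \<in> orientations leaf"
    unfolding orientations_def edge_leaf_iff by blast
  moreover have "indegree leaf_arcs v = outdegree leaf_arcs v" if "v \<in> vertices leaf" for v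
  proof -
    have "{u. (u, 0) \<in> leaf_arcs} = {2, 4}" "{u. (0, u) \<in> leaf_arcs} = {3, 5}"
      "{u. (u, 1) \<in> leaf_arcs} = {3, 5}" "{u. (1, u) \<in> leaf_arcs} = {2, 4}"
      "{u. (u, 2) \<in> leaf_arcs} = {1, 4}" "{u. (2, u) \<in> leaf_arcs} = {0, 3}"
      "{u. (u, 3) \<in> leaf_arcs} = {0, 2}" "{u. (3, u) \<in> leaf_arcs} = {1, 4}"
      "{u. (u, 4) \<in> leaf_arcs} = {1, 3}" "{u. (4, u) \<in> leaf_arcs} = {0, 2}"
      "{u. (u, 5) \<in> leaf_arcs} = {0}" "{u. (5, u) \<in> leaf_arcs} = {1}"
      by (simp_all add: leaf_arcs_def set_eq_iff, safe)
    then show ?thesis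
      using that by (auto simp: vertices_leaf)
  qed
  ultimately show ?thesis
    by (simp add: Eulerian_orientations_def)
qed

text \<open>Needed to turn the logarithm of a product of counts into a sum.\<close>

lemma card_Eulerian_leaf_pos: "card (Eulerian_orientations leaf) > 0"
  using leaf_arcs_Eulerian finite_Eulerian_orientations[OF simple_leaf]
  by (auto simp: card_gt_0_iff)

section \<open>Block trees and their entropies\<close>

text \<open>The parameters count the vertices of degree 2, which are the places where another block
  can be attached, all vertices, the Eulerian orientations, and the spanning trees.\<close>

definition realizable :: "nat \<Rightarrow> nat \<Rightarrow> nat \<Rightarrow> nat \<Rightarrow> bool" where
  "realizable s n e t \<longleftrightarrow> (\<exists>G :: nat ugraph.
     simple_graph G \<and> connected_graph G \<and> (\<forall>v\<in>vertices G. degree_of G v \<in> {2, 4}) \<and>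
     card {v \<in> vertices G. degree_of G v = 2} = s \<and> card (vertices G) = n \<and>
     card (Eulerian_orientations G) = e \<and> card (spanning_trees G) = t)"

text \<open>One open vertex of each graph is used up: the two merge into a vertex of degree 4, which
  also costs one vertex in the total.\<close>

lemma realizable_glue:
  assumes "realizable (Suc s1) n1 e1 t1" "realizable (Suc s2) n2 e2 t2"
  shows "realizable (s1 + s2) (n1 + n2 - 1) (e1 * e2) (t1 * t2)"
proof -
  obtain G :: "nat ugraph" where G: "simple_graph G" "connected_graph G"
    "\<forall>v\<in>vertices G. degree_of G v \<in> {2, 4}" "card {v \<in> vertices G. degree_of G v = 2} = Suc s1"
    "card (vertices G) = n1" "card (Eulerian_orientations G) = e1" "card (spanning_trees G) = t1"
    using assms(1) unfolding realizable_def by blast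
  obtain H :: "nat ugraph" where H: "simple_graph H" "connected_graph H"
    "\<forall>v\<in>vertices H. degree_of H v \<in> {2, 4}" "card {v \<in> vertices H. degree_of H v = 2} = Suc s2"
    "card (vertices H) = n2" "card (Eulerian_orientations H) = e2" "card (spanning_trees H) = t2"
    using assms(2) unfolding realizable_def by blast
  obtain u where u: "u \<in> vertices G" "degree_of G u = 2"
    using G(4) by (metis (mono_tags, lifting) Suc_neq_Zero card.empty empty_Collect_eq)
  obtain r where r: "r \<in> vertices H" "degree_of H r = 2"
    using H(4) by (metis (mono_tags, lifting) Suc_neq_Zero card.empty empty_Collect_eq)
  have finG: "finite (vertices G)" and finH: "finite (vertices H)"
    using G(1) H(1) by (simp_all add: simple_graph_def)
  \<comment> \<open>The copy of \<open>H\<close> is attached by sending \<open>r\<close> to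
    \<open>u\<close> and shifting all other labels beyond the largest vertex of \<open>G\<close>;
    this is injective on all naturals and meets \<open>G\<close> in \<open>u\<close> only.\<close>
  define f where "f x = (if x = r then u else Suc (Max (vertices G)) + x)" for x
  have big: "x \<le> Max (vertices G)" if "x \<in> vertices G" for x
    using finG that by simp
  have "inj f"
    using big[OF u(1)] by (auto simp: inj_def f_def)
  then interpret emb: graph_embedding f H
    using H(1) by unfold_locales
  define K where "K = map_graph f H"
  have vK: "vertices K = f ` vertices H"
    by (simp add: K_def map_graph_def)
  have meet: "vertices G \<inter> vertices K = {u}"
  proof (intro equalityI subsetI)
    fix x assume "x \<in> vertices G \<inter> vertices K"
    then obtain y where "x = f y" "x \<in> vertices G"
      by (auto simp: vK)
    then show "x \<in> {u}"
      using big[of x] by (simp add: f_def split: if_splits)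
  next
    fix x assume "x \<in> {u}"
    then show "x \<in> vertices G \<inter> vertices K"
      using u(1) r(1) by (auto simp: vK f_def intro!: image_eqI[of _ _ r])
  qed
  interpret one_point_union G K u
    using G(1) emb.simple_map meet by unfold_locales (simp_all add: K_def)
  have degK: "degree_of K (f v) = degree_of H v" for v
    by (simp add: K_def emb.degree_map)
  have "f r = u" by (simp add: f_def)
  then have degu: "degree_of K u = 2"
    using degK[of r] r(2) by simp
  define U where "U = union_graph G K"
  have vU: "vertices U = vertices G \<union> vertices K"
    by (simp add: U_def union_graph_def)
  have finK: "finite (vertices K)"
    using finH by (simp add: vK)
  have inG: "degree_of U v = degree_of G v" if "v \<in> vertices G - {u}" for v
  proof -
    have "v \<notin> vertices K" using that meet by blast
    then show ?thesis by (simp add: U_def degree_union degree_outside)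
  qed
  have inK: "degree_of U v = degree_of K v" if "v \<in> vertices K - {u}" for v
  proof -
    have "v \<notin> vertices G" using that meet by blast
    then show ?thesis by (simp add: U_def degree_union degree_outside)
  qed
  have atu: "degree_of U u = 4"
    using u(2) degu by (simp add: U_def degree_union)
  have "degree_of U v \<in> {2, 4}" if "v \<in> vertices U" for v
  proof -
    consider "v = u" | "v \<in> vertices G - {u}" | "v \<in> vertices K - {u}"
      using \<open>v \<in> vertices U\<close> unfolding vU by blast
    then show ?thesis
    proof cases
      case 1
      then show ?thesis using atu by simp
    next
      case 2
      then show ?thesis using inG[OF 2] G(3) by simp
    next
      case 3
      then obtain y where "y \<in> vertices H" "v = f y"
        by (auto simp: vK)
      then show ?thesis using inK[OF 3] degK[of y] H(3) by simp
    qed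
  qed
  moreover have "card {v \<in> vertices U. degree_of U v = 2} = s1 + s2"
  proof -
    let ?A = "{v \<in> vertices G. degree_of G v = 2}" and ?B = "{v \<in> vertices K. degree_of K v = 2}"
    have eq: "{v \<in> vertices U. degree_of U v = 2} = (?A - {u}) \<union> (?B - {u})"
    proof (rule set_eqI)
      fix v
      consider "v = u" | "v \<in> vertices G - {u}" "v \<notin> vertices K" | "v \<in> vertices K - {u}" "v \<notin> vertices G"
        | "v \<notin> vertices U"
        using meet unfolding vU by blast
      then show "v \<in> {v \<in> vertices U. degree_of U v = 2} \<longleftrightarrow> v \<in> (?A - {u}) \<union> (?B - {u})"
        by cases (simp_all add: atu inG inK, simp_all add: vU)
    qed
    have "?B = f ` {v \<in> vertices H. degree_of H v = 2}"
      using degK by (auto simp: vK)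
    then have "card ?B = Suc s2"
      using H(4) emb.inj by (simp add: card_image inj_on_subset)
    moreover have "u \<in> ?A" "u \<in> ?B"
      using u degu meet by auto
    moreover have "(?A - {u}) \<inter> (?B - {u}) = {}"
      using meet by auto
    ultimately show ?thesis
      unfolding eq using G(4) finG finK by (subst card_Un_disjoint) simp_all
  qed
  moreover have "card (vertices U) = n1 + n2 - 1"
    using card_Un_Int[OF finG finK] meet G(5) H(5) emb.card_vertices_map
    by (simp add: vU K_def)
  moreover have "connected_graph U" "simple_graph U"
    unfolding U_def using connected_union G(2) H(2) emb.connected_map simple_union
    by (simp_all add: K_def)
  moreover have "card (Eulerian_orientations U) = e1 * e2"
    unfolding U_def card_Eulerian_orientations_union
    using G(6) H(6) emb.card_Eulerian_orientations_map by (simp add: K_def)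
  moreover have "card (spanning_trees U) = t1 * t2"
    unfolding U_def card_spanning_trees_union
    using G(7) H(7) emb.card_spanning_trees_map by (simp add: K_def)
  ultimately show ?thesis
    unfolding realizable_def by blast
qed

lemma realizable_cycle:
  assumes "k \<ge> 3"
  shows "realizable k k 2 k"
proof -
  interpret cycle_graph k by (rule cycle_graph.intro) (rule assms)
  have "{v \<in> vertices C. degree_of C v = 2} = {..<k}"
    using degree_C by (auto simp: vertices_C)
  then show ?thesis
    unfolding realizable_def
    using simple_C connected_C degree_C card_Eulerian_orientations_C card_spanning_trees_C
    by (intro exI[of _ C]) (simp add: vertices_C)
qed

abbreviation leaf_orientations :: nat where
  "leaf_orientations \<equiv> card (Eulerian_orientations leaf)"

abbreviation leaf_trees :: nat where
  "leaf_trees \<equiv> card (spanning_trees leaf)"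

lemma realizable_leaf: "realizable 1 6 leaf_orientations leaf_trees"
proof -
  have "{v \<in> vertices leaf. degree_of leaf v = 2} = {5}"
    by (auto simp: vertices_leaf degree_leaf simp del: One_nat_def)
  moreover have "\<forall>v\<in>vertices leaf. degree_of leaf v \<in> {2, 4}"
    by (simp add: vertices_leaf degree_leaf del: One_nat_def)
  ultimately show ?thesis
    unfolding realizable_def
    using simple_leaf connected_leaf by (intro exI[of _ leaf]) (simp add: vertices_leaf)
qed

text \<open>Each leaf closes one open vertex and brings \<open>6 - 1\<close> new vertices.\<close>

lemma realizable_attach_leaves:
  assumes "realizable (s + m) n e t"
  shows "realizable s (n + 5 * m) (e * leaf_orientations ^ m) (t * leaf_trees ^ m)"
  using assms
proof (induction m arbitrary: n e t)
  case (Suc m)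
  have "realizable (s + m + 0) (n + 6 - 1) (e * leaf_orientations) (t * leaf_trees)"
    by (rule realizable_glue) (use Suc.prems realizable_leaf in simp_all)
  then have "realizable (s + m) (n + 5) (e * leaf_orientations) (t * leaf_trees)"
    by (simp add: add.commute)
  from Suc.IH[OF this] show ?case
    by (simp add: mult.assoc add.assoc)
qed simp

text \<open>Of the \<open>j + 2\<close> cycle vertices, one is glued to the graph, \<open>j\<close>
  receive leaves and one stays open, so the step can be iterated; it adds
  \<open>(j + 1) + 5 j\<close> vertices. \<open>j \<ge> 1\<close> makes the cycle long enough for a
  simple graph, and \<open>k\<close> is a separate variable so that instances show the numerals 3,
  4, 5.\<close>

lemma realizable_attach_block:
  assumes "realizable 1 n e t" "j \<ge> 1" "k = j + 2"
  shows "realizable 1 (n + (6 * j + 1)) (e * (2 * leaf_orientations ^ j)) (t * (k * leaf_trees ^ j))"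
proof -
  have "realizable (Suc (j + 1)) (j + 2) 2 (j + 2)"
    using realizable_cycle[of "j + 2"] assms(2) by simp
  then have "realizable (1 + j) (n + (j + 1)) (e * 2) (t * (j + 2))"
    using realizable_glue[of 0 n e t "j + 1" "j + 2" 2 "j + 2"] assms(1) by simp
  from realizable_attach_leaves[OF this] show ?thesis
    by (simp add: assms(3) algebra_simps)
qed

lemma realizable_attach_blocks:
  assumes "realizable 1 n e t" "j \<ge> 1" "k = j + 2"
  shows "realizable 1 (n + (6 * j + 1) * m)
    (e * (2 * leaf_orientations ^ j) ^ m) (t * (k * leaf_trees ^ j) ^ m)"
proof (induction m)
  case (Suc m)
  then show ?case
    using realizable_attach_block[OF Suc assms(2,3)] by (simp add: algebra_simps)
qed (use assms(1) in simp)

text \<open>\<open>a\<close>, \<open>b\<close>, \<open>c\<close> count the blocks with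
  \<open>j = 1, 2, 3\<close>. A second leaf closes the last open vertex, whence the squares and
  \<open>11 = 6 + 6 - 1\<close>.\<close>

lemma realizable_block_tree:
  "realizable 0 (11 + 7 * a + 13 * b + 19 * c)
    (leaf_orientations ^ 2 * (2 * leaf_orientations) ^ a * (2 * leaf_orientations ^ 2) ^ b
      * (2 * leaf_orientations ^ 3) ^ c)
    (leaf_trees ^ 2 * (3 * leaf_trees) ^ a * (4 * leaf_trees ^ 2) ^ b * (5 * leaf_trees ^ 3) ^ c)"
proof -
  let ?E = leaf_orientations and ?T = leaf_trees
  have "realizable 1 (6 + 7 * a) (?E * (2 * ?E) ^ a) (?T * (3 * ?T) ^ a)"
    using realizable_attach_blocks[OF realizable_leaf, of 1 3 a] by simp
  from realizable_attach_blocks[OF this, of 2 4 b]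
  have "realizable 1 (6 + 7 * a + 13 * b) (?E * (2 * ?E) ^ a * (2 * ?E ^ 2) ^ b)
      (?T * (3 * ?T) ^ a * (4 * ?T ^ 2) ^ b)"
    by simp
  from realizable_attach_blocks[OF this, of 3 5 c]
  have "realizable 1 (6 + 7 * a + 13 * b + 19 * c)
      (?E * (2 * ?E) ^ a * (2 * ?E ^ 2) ^ b * (2 * ?E ^ 3) ^ c)
      (?T * (3 * ?T) ^ a * (4 * ?T ^ 2) ^ b * (5 * ?T ^ 3) ^ c)"
    by simp
  then have "realizable (0 + 0) (6 + (6 + 7 * a + 13 * b + 19 * c) - 1)
      (?E * (?E * (2 * ?E) ^ a * (2 * ?E ^ 2) ^ b * (2 * ?E ^ 3) ^ c))
      (?T * (?T * (3 * ?T) ^ a * (4 * ?T ^ 2) ^ b * (5 * ?T ^ 3) ^ c))"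
    using realizable_leaf by (intro realizable_glue) simp_all
  then show ?thesis
    by (simp add: power2_eq_square mult.assoc add.assoc)
qed

section \<open>Limits for prescribed proportions of blocks\<close>

lemma floor_multiple_tendsto:
  fixes \<alpha> :: real
  assumes "\<alpha> \<ge> 0"
  shows "(\<lambda>i. real (nat \<lfloor>\<alpha> * real i\<rfloor>) / real i) \<longlonglongrightarrow> \<alpha>"
proof (rule tendsto_sandwich)
  have bounds: "\<alpha> - 1 / real i \<le> real (nat \<lfloor>\<alpha> * real i\<rfloor>) / real i"
    "real (nat \<lfloor>\<alpha> * real i\<rfloor>) / real i \<le> \<alpha>" if "i > 0" for i
  proof -
    have "real (nat \<lfloor>\<alpha> * real i\<rfloor>) = real_of_int \<lfloor>\<alpha> * real i\<rfloor>"
      using assms by simp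
    then have "\<alpha> * real i - 1 \<le> real (nat \<lfloor>\<alpha> * real i\<rfloor>)" "real (nat \<lfloor>\<alpha> * real i\<rfloor>) \<le> \<alpha> * real i"
      by linarith+
    then show "\<alpha> - 1 / real i \<le> real (nat \<lfloor>\<alpha> * real i\<rfloor>) / real i"
      "real (nat \<lfloor>\<alpha> * real i\<rfloor>) / real i \<le> \<alpha>"
      using that divide_right_mono[of "\<alpha> * real i - 1" "real (nat \<lfloor>\<alpha> * real i\<rfloor>)" "real i"]
      by (simp_all add: diff_divide_distrib pos_divide_le_eq)
  qed
  show "\<forall>\<^sub>F i in sequentially. \<alpha> - 1 / real i \<le> real (nat \<lfloor>\<alpha> * real i\<rfloor>) / real i"
    "\<forall>\<^sub>F i in sequentially. real (nat \<lfloor>\<alpha> * real i\<rfloor>) / real i \<le> \<alpha>"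
    by (rule eventually_sequentiallyI[of 1]; rule bounds; simp)+
  show "(\<lambda>i. \<alpha> - 1 / real i) \<longlonglongrightarrow> \<alpha>"
    using tendsto_diff[OF tendsto_const lim_const_over_n[of 1], of \<alpha>] by simp
qed simp

text \<open>Slope at least 1 makes the floor grow at every step; this is what later makes the number
  of vertices strictly increasing.\<close>

lemma floor_multiple_less:
  fixes \<alpha> :: real
  assumes "\<alpha> \<ge> 1"
  shows "nat \<lfloor>\<alpha> * real i\<rfloor> < nat \<lfloor>\<alpha> * real (Suc i)\<rfloor>"
proof -
  have "\<lfloor>\<alpha> * real i\<rfloor> + 1 \<le> \<lfloor>\<alpha> * real (Suc i)\<rfloor>"
    using assms by (simp add: le_floor_iff algebra_simps) linarith
  moreover have "0 \<le> \<lfloor>\<alpha> * real i\<rfloor>"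
    using assms by simp
  ultimately show ?thesis by linarith
qed

text \<open>Dividing numerator and denominator by \<open>i\<close> makes the constant terms, which
  come from the two end leaves, vanish in the limit.\<close>

lemma affine_quotient_tendsto:
  fixes a b c :: "nat \<Rightarrow> real"
  assumes "(\<lambda>i. a i / real i) \<longlonglongrightarrow> \<alpha>" "(\<lambda>i. b i / real i) \<longlonglongrightarrow> \<beta>" "(\<lambda>i. c i / real i) \<longlonglongrightarrow> \<gamma>"
    and "\<alpha> * x' + \<beta> * y' + \<gamma> * z' \<noteq> 0"
  shows "(\<lambda>i. (w + a i * x + b i * y + c i * z) / (w' + a i * x' + b i * y' + c i * z'))
    \<longlonglongrightarrow> (\<alpha> * x + \<beta> * y + \<gamma> * z) / (\<alpha> * x' + \<beta> * y' + \<gamma> * z')"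
proof -
  have lim: "(\<lambda>i. w / real i + a i / real i * x + b i / real i * y + c i / real i * z)
      \<longlonglongrightarrow> 0 + \<alpha> * x + \<beta> * y + \<gamma> * z" for w x y z :: real
    by (intro tendsto_intros assms lim_const_over_n)
  have "(\<lambda>i. (w / real i + a i / real i * x + b i / real i * y + c i / real i * z)
        / (w' / real i + a i / real i * x' + b i / real i * y' + c i / real i * z'))
      \<longlonglongrightarrow> (0 + \<alpha> * x + \<beta> * y + \<gamma> * z) / (0 + \<alpha> * x' + \<beta> * y' + \<gamma> * z')"
    using assms(4) by (intro tendsto_divide lim) simp
  moreover have "(w / real i + a i / real i * x + b i / real i * y + c i / real i * z)
        / (w' / real i + a i / real i * x' + b i / real i * y' + c i / real i * z')
      = (w + a i * x + b i * y + c i * z) / (w' + a i * x' + b i * y' + c i * z')" if "i > 0" for i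
  proof -
    have scale: "w / real i + a i / real i * x + b i / real i * y + c i / real i * z
        = (w + a i * x + b i * y + c i * z) / real i" for w x y z
      by (simp add: add_divide_distrib)
    show ?thesis
      unfolding scale using that by simp
  qed
  then have "\<forall>\<^sub>F i in sequentially.
      (w / real i + a i / real i * x + b i / real i * y + c i / real i * z)
        / (w' / real i + a i / real i * x' + b i / real i * y' + c i / real i * z')
      = (w + a i * x + b i * y + c i * z) / (w' + a i * x' + b i * y' + c i * z')"
    by (auto intro!: eventually_sequentiallyI[of 1])
  ultimately show ?thesis
    by (simp add: tendsto_cong)
qed

text \<open>The common shape of both counts: \<open>(p, q, r)\<close> is \<open>(3, 4, 5)\<close>
  for trees and \<open>(2, 2, 2)\<close> for orientations.\<close>

lemma ln_block_product:
  fixes x p q r :: nat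
  assumes "x > 0" "p > 0" "q > 0" "r > 0"
  shows "ln (real (x ^ 2 * (p * x) ^ a * (q * x ^ 2) ^ b * (r * x ^ 3) ^ c))
    = 2 * ln x + real a * (ln p + ln x) + real b * (ln q + 2 * ln x) + real c * (ln r + 3 * ln x)"
  using assms by (simp add: ln_mult ln_realpow)

lemma leaf_trees_pos: "leaf_trees > 0"
  using spanning_trees_nonempty[OF simple_leaf connected_leaf] finite_spanning_trees[OF simple_leaf]
  by (simp add: card_gt_0_iff)

text \<open>The proportions must be allowed to be real, since the direction chosen in the final
  argument has combinations of logarithms as coordinates; the numbers of blocks are floors of
  multiples.\<close>

lemma block_tree_sequence:
  fixes \<alpha> \<beta> \<gamma> :: real
  defines "\<epsilon> \<equiv> ln (real leaf_orientations)" and "\<tau> \<equiv> ln (real leaf_trees)"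
  assumes "\<alpha> \<ge> 1" "\<beta> \<ge> 1" "\<gamma> \<ge> 1"
  obtains G :: "nat \<Rightarrow> nat ugraph" where
    "\<And>i. simple_graph (G i) \<and> connected_graph (G i) \<and> regular_graph 4 (G i)"
    "strict_mono (\<lambda>i. card (vertices (G i)))"
    "(\<lambda>i. spanning_tree_entropy (G i)) \<longlonglongrightarrow>
      (\<alpha> * (ln 3 + \<tau>) + \<beta> * (ln 4 + 2 * \<tau>) + \<gamma> * (ln 5 + 3 * \<tau>)) / (\<alpha> * 7 + \<beta> * 13 + \<gamma> * 19)"
    "(\<lambda>i. residual_entropy (G i)) \<longlonglongrightarrow>
      (\<alpha> * (ln 2 + \<epsilon>) + \<beta> * (ln 2 + 2 * \<epsilon>) + \<gamma> * (ln 2 + 3 * \<epsilon>)) / (\<alpha> * 7 + \<beta> * 13 + \<gamma> * 19)"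
proof -
  define a b c where "a i = nat \<lfloor>\<alpha> * real i\<rfloor>" and "b i = nat \<lfloor>\<beta> * real i\<rfloor>"
    and "c i = nat \<lfloor>\<gamma> * real i\<rfloor>" for i
  have "\<exists>G :: nat ugraph. simple_graph G \<and> connected_graph G \<and> regular_graph 4 G \<and>
      card (vertices G) = 11 + 7 * a i + 13 * b i + 19 * c i \<and>
      card (Eulerian_orientations G) = leaf_orientations ^ 2 * (2 * leaf_orientations) ^ a i
        * (2 * leaf_orientations ^ 2) ^ b i * (2 * leaf_orientations ^ 3) ^ c i \<and>
      card (spanning_trees G) = leaf_trees ^ 2 * (3 * leaf_trees) ^ a i * (4 * leaf_trees ^ 2) ^ b i
        * (5 * leaf_trees ^ 3) ^ c i" for i
  proof -
    obtain G :: "nat ugraph" where G: "simple_graph G" "connected_graph G"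
      "\<forall>v\<in>vertices G. degree_of G v \<in> {2, 4}" "card {v \<in> vertices G. degree_of G v = 2} = 0"
      "card (vertices G) = 11 + 7 * a i + 13 * b i + 19 * c i"
      "card (Eulerian_orientations G) = leaf_orientations ^ 2 * (2 * leaf_orientations) ^ a i
        * (2 * leaf_orientations ^ 2) ^ b i * (2 * leaf_orientations ^ 3) ^ c i"
      "card (spanning_trees G) = leaf_trees ^ 2 * (3 * leaf_trees) ^ a i * (4 * leaf_trees ^ 2) ^ b i
        * (5 * leaf_trees ^ 3) ^ c i"
      using realizable_block_tree[of "a i" "b i" "c i"] unfolding realizable_def by blast
    have "finite {v \<in> vertices G. degree_of G v = 2}"
      using G(1) by (simp add: simple_graph_def)
    then have "{v \<in> vertices G. degree_of G v = 2} = {}"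
      using G(4) by (simp only: card_0_eq)
    then have "regular_graph 4 G"
      using G(3) by (auto simp: regular_graph_def)
    then show ?thesis
      using G by blast
  qed
  then obtain G :: "nat \<Rightarrow> nat ugraph" where
    G: "\<And>i. simple_graph (G i) \<and> connected_graph (G i) \<and> regular_graph 4 (G i)" and
    n: "\<And>i. card (vertices (G i)) = 11 + 7 * a i + 13 * b i + 19 * c i" and
    e: "\<And>i. card (Eulerian_orientations (G i)) = leaf_orientations ^ 2 * (2 * leaf_orientations) ^ a i
        * (2 * leaf_orientations ^ 2) ^ b i * (2 * leaf_orientations ^ 3) ^ c i" and
    t: "\<And>i. card (spanning_trees (G i)) = leaf_trees ^ 2 * (3 * leaf_trees) ^ a i
        * (4 * leaf_trees ^ 2) ^ b i * (5 * leaf_trees ^ 3) ^ c i"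
    by metis
  have lims: "(\<lambda>i. real (a i) / real i) \<longlonglongrightarrow> \<alpha>" "(\<lambda>i. real (b i) / real i) \<longlonglongrightarrow> \<beta>"
    "(\<lambda>i. real (c i) / real i) \<longlonglongrightarrow> \<gamma>"
    unfolding a_def b_def c_def using assms(3-5) by (intro floor_multiple_tendsto; simp)+
  have nz: "\<alpha> * 7 + \<beta> * 13 + \<gamma> * 19 \<noteq> 0"
    using assms(3-5) by linarith
  have real_n: "real (card (vertices (G i))) = 11 + real (a i) * 7 + real (b i) * 13 + real (c i) * 19"
    for i
    by (simp add: n)
  show ?thesis
  proof (rule that[of G])
    show "simple_graph (G i) \<and> connected_graph (G i) \<and> regular_graph 4 (G i)" for i
      by (rule G)
    have "a i < a (Suc i)" "b i < b (Suc i)" "c i < c (Suc i)" for i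
      unfolding a_def b_def c_def using assms(3-5) by (intro floor_multiple_less; simp)+
    then have "card (vertices (G i)) < card (vertices (G (Suc i)))" for i
      unfolding n by (meson add_strict_mono add_strict_left_mono mult_less_mono2 zero_less_numeral)
    then show "strict_mono (\<lambda>i. card (vertices (G i)))"
      by (simp add: strict_mono_Suc_iff)
    have "spanning_tree_entropy (G i) = (2 * \<tau> + real (a i) * (ln 3 + \<tau>) + real (b i) * (ln 4 + 2 * \<tau>)
        + real (c i) * (ln 5 + 3 * \<tau>)) / (11 + real (a i) * 7 + real (b i) * 13 + real (c i) * 19)" for i
      unfolding spanning_tree_entropy_def real_n t \<tau>_def
      using ln_block_product[OF leaf_trees_pos, of 3 4 5] by simp
    then show "(\<lambda>i. spanning_tree_entropy (G i)) \<longlonglongrightarrow>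
      (\<alpha> * (ln 3 + \<tau>) + \<beta> * (ln 4 + 2 * \<tau>) + \<gamma> * (ln 5 + 3 * \<tau>)) / (\<alpha> * 7 + \<beta> * 13 + \<gamma> * 19)"
      using affine_quotient_tendsto[OF lims nz] by simp
    have "residual_entropy (G i) = (2 * \<epsilon> + real (a i) * (ln 2 + \<epsilon>) + real (b i) * (ln 2 + 2 * \<epsilon>)
        + real (c i) * (ln 2 + 3 * \<epsilon>)) / (11 + real (a i) * 7 + real (b i) * 13 + real (c i) * 19)" for i
      unfolding residual_entropy_def real_n e \<epsilon>_def
      using ln_block_product[OF card_Eulerian_leaf_pos, of 2 2 2] by simp
    then show "(\<lambda>i. residual_entropy (G i)) \<longlonglongrightarrow>
      (\<alpha> * (ln 2 + \<epsilon>) + \<beta> * (ln 2 + 2 * \<epsilon>) + \<gamma> * (ln 2 + 3 * \<epsilon>)) / (\<alpha> * 7 + \<beta> * 13 + \<gamma> * 19)"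
      using affine_quotient_tendsto[OF lims nz] by simp
  qed
qed

section \<open>Two vectors of proportions with equal tree entropy and different residual
  entropy\<close>

theorem theorem2p9:
  shows "\<not> (\<exists>\<rho>' :: nat \<Rightarrow> real \<Rightarrow> real. \<forall>(d::nat) (\<tau>::real). even d \<longrightarrow>
    (\<forall>G :: nat \<Rightarrow> nat ugraph.
       (\<forall>i. simple_graph (G i) \<and> connected_graph (G i) \<and> regular_graph d (G i)) \<and>
       strict_mono (\<lambda>i. card (vertices (G i))) \<and>
       (\<lambda>i. spanning_tree_entropy (G i)) \<longlonglongrightarrow> \<tau>
       \<longrightarrow> (\<lambda>i. residual_entropy (G i)) \<longlonglongrightarrow> \<rho>' d \<tau>))"
  (is "\<not> Ex ?P")
proof (rule notI, erule exE)
  fix \<rho>' :: "nat \<Rightarrow> real \<Rightarrow> real"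
  assume "?P \<rho>'"
  note universal = this[THEN spec, THEN spec, THEN mp, THEN spec, THEN mp]
  define \<epsilon> \<tau> where "\<epsilon> = ln (real leaf_orientations)" and "\<tau> = ln (real leaf_trees)"
  define A B C where "A = ln 3 + \<tau>" and "B = ln 4 + 2 * \<tau>" and "C = ln 5 + 3 * \<tau>"
  \<comment> \<open>Every vector of proportions fixes the value of \<open>\<rho>'\<close> at its
    tree entropy, so two vectors with the same tree entropy must agree in residual entropy.\<close>
  have limit: "\<rho>' 4 ((\<alpha> * A + \<beta> * B + \<gamma> * C) / (\<alpha> * 7 + \<beta> * 13 + \<gamma> * 19))
      = (\<alpha> * (ln 2 + \<epsilon>) + \<beta> * (ln 2 + 2 * \<epsilon>) + \<gamma> * (ln 2 + 3 * \<epsilon>)) / (\<alpha> * 7 + \<beta> * 13 + \<gamma> * 19)"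
    if ge: "\<alpha> \<ge> 1" "\<beta> \<ge> 1" "\<gamma> \<ge> 1" for \<alpha> \<beta> \<gamma>
  proof -
    obtain G :: "nat \<Rightarrow> nat ugraph" where G:
      "\<And>i. simple_graph (G i) \<and> connected_graph (G i) \<and> regular_graph 4 (G i)"
      "strict_mono (\<lambda>i. card (vertices (G i)))"
      "(\<lambda>i. spanning_tree_entropy (G i)) \<longlonglongrightarrow> (\<alpha> * A + \<beta> * B + \<gamma> * C) / (\<alpha> * 7 + \<beta> * 13 + \<gamma> * 19)"
      "(\<lambda>i. residual_entropy (G i)) \<longlonglongrightarrow>
        (\<alpha> * (ln 2 + \<epsilon>) + \<beta> * (ln 2 + 2 * \<epsilon>) + \<gamma> * (ln 2 + 3 * \<epsilon>)) / (\<alpha> * 7 + \<beta> * 13 + \<gamma> * 19)"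
      by (rule block_tree_sequence[OF ge, folded \<epsilon>_def \<tau>_def, folded A_def B_def C_def]) (rule that; simp)
    have "(\<lambda>i. residual_entropy (G i)) \<longlonglongrightarrow>
        \<rho>' 4 ((\<alpha> * A + \<beta> * B + \<gamma> * C) / (\<alpha> * 7 + \<beta> * 13 + \<gamma> * 19))"
      by (rule universal) (use G in simp_all)
    then show ?thesis
      using G(4) by (rule LIMSEQ_unique)
  qed
  text \<open>This direction is the cross product of \<open>(7, 13, 19)\<close> and \<open>(A, B, C)\<close>, so that moving along
    it changes neither the number of vertices nor the spanning tree entropy.\<close>
  define u v w where "u = 13 * C - 19 * B" and "v = 19 * A - 7 * C" and "w = 7 * B - 13 * A"
  \<comment> \<open>Chosen so large that the base point \<open>(P, P, P)\<close> and its shift by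
    \<open>(u, v, w)\<close> both have all coordinates at least 1, as \<open>limit\<close>
    demands.\<close>
  define P where "P = 1 + \<bar>u\<bar> + \<bar>v\<bar> + \<bar>w\<bar>"
  have vertices0: "7 * u + 13 * v + 19 * w = 0" and trees0: "A * u + B * v + C * w = 0"
    by (simp_all add: u_def v_def w_def algebra_simps)
  have bounds: "P \<ge> 1" "P + u \<ge> 1" "P + v \<ge> 1" "P + w \<ge> 1"
    unfolding P_def by linarith+
  have n: "(P + u) * 7 + (P + v) * 13 + (P + w) * 19 = P * 7 + P * 13 + P * 19"
    using vertices0 by (simp add: algebra_simps)
  have t: "(P + u) * A + (P + v) * B + (P + w) * C = P * A + P * B + P * C"
    using trees0 by (simp add: algebra_simps)
  have "P * 7 + P * 13 + P * 19 \<noteq> 0"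
    using bounds(1) by linarith
  then have "(P + u) * (ln 2 + \<epsilon>) + (P + v) * (ln 2 + 2 * \<epsilon>) + (P + w) * (ln 2 + 3 * \<epsilon>)
      = P * (ln 2 + \<epsilon>) + P * (ln 2 + 2 * \<epsilon>) + P * (ln 2 + 3 * \<epsilon>)"
    using limit[OF bounds(2-4)] limit[OF bounds(1) bounds(1) bounds(1)] unfolding n t by simp
  then have "u * (ln 2 + \<epsilon>) + v * (ln 2 + 2 * \<epsilon>) + w * (ln 2 + 3 * \<epsilon>) = 0"
    by (simp add: algebra_simps)
  \<comment> \<open>Coefficientwise, \<open>ln 2 + j * \<epsilon> = ln 2 * (6 * j + 1) + j *
    (\<epsilon> - 6 * ln 2)\<close>; the first part is a multiple of the vertex increment and is
    killed by \<open>vertices0\<close>.\<close>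
  moreover have "u * (ln 2 + \<epsilon>) + v * (ln 2 + 2 * \<epsilon>) + w * (ln 2 + 3 * \<epsilon>)
      = (\<epsilon> - 6 * ln 2) * (u + 2 * v + 3 * w) + ln 2 * (7 * u + 13 * v + 19 * w)"
    by (simp add: algebra_simps)
  ultimately have "(\<epsilon> - 6 * ln 2) * (u + 2 * v + 3 * w) = 0"
    using vertices0 by simp
  moreover have "\<epsilon> - 6 * ln 2 \<noteq> 0"
  proof -
    have "\<epsilon> < ln 64"
      unfolding \<epsilon>_def using card_Eulerian_leaf_less card_Eulerian_leaf_pos by simp
    moreover have "ln 64 = 6 * ln (2 :: real)"
      using ln_realpow[of 2 6] by simp
    ultimately show ?thesis by simp
  qed
  moreover have "u + 2 * v + 3 * w \<noteq> 0"
  proof -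
    \<comment> \<open>The combination equals \<open>2 * B - A - C\<close>, minus a second
      difference, so the terms linear in \<open>j\<close>, that is those with \<open>\<tau>\<close>,
      cancel.\<close>
    have "u + 2 * v + 3 * w = 2 * ln 4 - (ln 3 + ln 5)"
      by (simp add: u_def v_def w_def A_def B_def C_def)
    also have "\<dots> = ln 16 - ln 15"
      using ln_realpow[of 4 2] ln_mult[of 3 "5 :: real"] by simp
    finally show ?thesis by simp
  qed
  ultimately show False by simp
qed

end
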